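(* Let $k\ge 1$ be an integer, let $a,c,f,\gamma,\varepsilon_0,\lambda$ be as in the context with $\lambda\in(0,k+1)$, and let $0<\alpha\le \min\{\lambda/(k+1),\,1/(2(k+1))\}$. Then there is a constant $C>0$, independent of $\varepsilon$ and $N$ (it may depend on $\alpha$, $k$ and the data $a,c,f,\lambda$), such that for all $\varepsilon\in(0,\varepsilon_0]$ and all integers $N\ge 1$ the following holds. If $u$ is the solution of the boundary value problem $$-\varepsilon u''(x)+a(x)u'(x)+c(x)u(x)=f(x)\ \text{ in }(-1,1),\qquad u(-1)=u(1)=0,$$ and $u_N\in V^N$ is the finite element solution of order $k$ on the mesh $x_i=\varphi(i/N,\varepsilon)$, $i=-N,\dots,N$, i.e. $B_\varepsilon(u_N,v_N)=(f,v_N)$ for all $v_N\in V^N$, then $$|||u-u_N|||_\varepsilon\le C N^{-k}.$$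
   Context: Data: $a,c,f$ are sufficiently smooth functions on $[-1,1]$ (independent of $\varepsilon$) with $a(x)=-x\,b(x)$, $b(x)>0$, $c(x)\ge 0$ on $[-1,1]$ and $c(0)>0$ (simple interior turning point at $x_0=0$). There is a constant $\gamma>0$ with $(c-\tfrac12 a')(x)\ge\gamma$ for all $x\in[-1,1]$, and $\varepsilon$ is sufficiently small: $0<\varepsilon\le\varepsilon_0$ for some sufficiently small $\varepsilon_0\in(0,1]$. Parameter $\lambda$: put $\bar\lambda=c(0)/|a'(0)|$; $\lambda$ is a fixed number with $0<\lambda<\bar\lambda$ ($\lambda=\bar\lambda$ is also allowed if $\bar\lambda$ is not an integer). It is known that the solution $u=u(\cdot,\varepsilon)$ then satisfies $|u^{(i)}(x)|\le C\bigl(1+(\varepsilon^{1/2}+|x|)^{\lambda-i}\bigr)$ for $x\in[-1,1]$, with $C$ independent of $\varepsilon$ and $x$, for all derivative orders $i$ permitted by the smoothness of the data (in particular for $0\le i\le k+1$); this may be used. Mesh generating function: for $0\le\xi\le1$, $$\varphi(\xi,\varepsilon)=\Bigl(\varepsilon^{\alpha/2}+\xi\bigl[(1+\varepsilon^{1/2})^\alpha-\varepsilon^{\alpha/2}\bigr]\Bigr)^{1/\alpha}-\varepsilon^{1/2},$$ and for $-1\le\xi\le0$, $\varphi(\xi,\varepsilon)=\varepsilon^{1/2}-\bigl(\varepsilon^{\alpha/2}-\xi[(1+\varepsilon^{1/2})^\alpha-\varepsilon^{\alpha/2}]\bigr)^{1/\alpha}$. Finite element space: $V^N=\{v\in C([-1,1]):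 v|_{(x_{i-1},x_i)}\text{ is a polynomial of degree}\le k\ \forall i=-N+1,\dots,N,\ v(-1)=v(1)=0\}$. Bilinear form: $B_\varepsilon(v,w)=\varepsilon(v',w')+(av',w)+(cv,w)$, where $(\cdot,\cdot)$ is the $L^2((-1,1))$ inner product with norm $\|\cdot\|$. Energy norm: $|||v|||_\varepsilon=\bigl(\varepsilon\|v'\|^2+\|v\|^2\bigr)^{1/2}$ for $v\in H^1((-1,1))$. *)

theory Defs
  imports "HOL-Analysis.Analysis" "HOL-Computational_Algebra.Polynomial"
begin

(* Derivatives are taken within the closed interval [-1,1]: two-sided at interior points,
   one-sided at -1 and 1. *)
primrec iter_deriv :: "nat \<Rightarrow> (real \<Rightarrow> real) \<Rightarrow> real \<Rightarrow> real" where
  "iter_deriv 0 g = g"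
| "iter_deriv (Suc i) g = (\<lambda>x. vector_derivative (iter_deriv i g) (at x within {-1..1}))"

definition Cn :: "nat \<Rightarrow> (real \<Rightarrow> real) \<Rightarrow> bool" where
  "Cn m g \<longleftrightarrow>
     (\<forall>i<m. \<forall>x\<in>{-1..1}. iter_deriv i g differentiable (at x within {-1..1})) \<and>
     continuous_on {-1..1} (iter_deriv m g)"

definition bvp_solution ::
  "(real \<Rightarrow> real) \<Rightarrow> (real \<Rightarrow> real) \<Rightarrow> (real \<Rightarrow> real) \<Rightarrow> real \<Rightarrow> (real \<Rightarrow> real) \<Rightarrow> bool" where
  "bvp_solution a c f \<epsilon> u \<longleftrightarrow>
     continuous_on {-1..1} u \<and> u (-1) = 0 \<and> u 1 = 0 \<and>
     (\<forall>x\<in>{-1<..<1}. u differentiable (at x) \<and> deriv u differentiable (at x) \<and>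
        - \<epsilon> * deriv (deriv u) x + a x * deriv u x + c x * u x = f x)"

(* The a priori bound |u^(i)(x)| <= C (1 + (eps^(1/2) + |x|)^(lam - i)), 0 <= i <= m, known from
   the literature on simple interior turning points. C is independent of eps and x. Existence
   and continuity of the derivatives that are bounded is part of the bound. *)
definition derivative_bounds ::
  "(real \<Rightarrow> real) \<Rightarrow> (real \<Rightarrow> real) \<Rightarrow> (real \<Rightarrow> real) \<Rightarrow> real \<Rightarrow> real \<Rightarrow> nat \<Rightarrow> bool" where
  "derivative_bounds a c f \<epsilon>\<^sub>0 lam m \<longleftrightarrow>
     (\<exists>C. \<forall>\<epsilon> u. 0 < \<epsilon> \<and> \<epsilon> \<le> \<epsilon>\<^sub>0 \<and> bvp_solution a c f \<epsilon> u \<longrightarrow>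
        Cn m u \<and>
        (\<forall>i\<le>m. \<forall>x\<in>{-1..1}.
           \<bar>iter_deriv i u x\<bar> \<le> C * (1 + (\<epsilon> powr (1/2) + \<bar>x\<bar>) powr (lam - real i))))"

definition mesh_fun :: "real \<Rightarrow> real \<Rightarrow> real \<Rightarrow> real" where
  "mesh_fun \<alpha> \<xi> \<epsilon> =
     (if 0 \<le> \<xi>
      then (\<epsilon> powr (\<alpha>/2) + \<xi> * ((1 + \<epsilon> powr (1/2)) powr \<alpha> - \<epsilon> powr (\<alpha>/2))) powr (1/\<alpha>)
             - \<epsilon> powr (1/2)
      else \<epsilon> powr (1/2)
             - (\<epsilon> powr (\<alpha>/2) - \<xi> * ((1 + \<epsilon> powr (1/2)) powr \<alpha> - \<epsilon> powr (\<alpha>/2))) powr (1/\<alpha>))"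

definition mesh_point :: "real \<Rightarrow> real \<Rightarrow> nat \<Rightarrow> int \<Rightarrow> real" where
  "mesh_point \<alpha> \<epsilon> N i = mesh_fun \<alpha> (real_of_int i / real N) \<epsilon>"

definition fe_space :: "nat \<Rightarrow> real \<Rightarrow> real \<Rightarrow> nat \<Rightarrow> (real \<Rightarrow> real) set" where
  "fe_space k \<alpha> \<epsilon> N =
     {v. continuous_on {-1..1} v \<and> v (-1) = 0 \<and> v 1 = 0 \<and>
         (\<forall>i\<in>{- int N + 1..int N}. \<exists>p :: real poly. degree p \<le> k \<and>
            (\<forall>x\<in>{mesh_point \<alpha> \<epsilon> N (i - 1)<..<mesh_point \<alpha> \<epsilon> N i}. v x = poly p x))}"

definition L2_inner :: "(real \<Rightarrow> real) \<Rightarrow> (real \<Rightarrow> real) \<Rightarrow> real" where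
  "L2_inner g h = (LINT x:{-1<..<1}|lborel. g x * h x)"

definition L2_norm :: "(real \<Rightarrow> real) \<Rightarrow> real" where
  "L2_norm g = sqrt (L2_inner g g)"

(* The bilinear form and the energy norm are applied only to continuous functions that are
   continuously differentiable on [-1,1] outside the finite set of mesh points, with bounded
   derivative. For these, deriv is the weak derivative up to its (irrelevant) values on that
   finite set. *)
definition bilinear ::
  "(real \<Rightarrow> real) \<Rightarrow> (real \<Rightarrow> real) \<Rightarrow> real \<Rightarrow> (real \<Rightarrow> real) \<Rightarrow> (real \<Rightarrow> real) \<Rightarrow> real" where
  "bilinear a c \<epsilon> v w =
     \<epsilon> * L2_inner (deriv v) (deriv w) + L2_inner (\<lambda>x. a x * deriv v x) w
       + L2_inner (\<lambda>x. c x * v x) w"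

definition energy_norm :: "real \<Rightarrow> (real \<Rightarrow> real) \<Rightarrow> real" where
  "energy_norm \<epsilon> v = sqrt (\<epsilon> * (L2_norm (deriv v))\<^sup>2 + (L2_norm v)\<^sup>2)"

definition fe_solution ::
  "(real \<Rightarrow> real) \<Rightarrow> (real \<Rightarrow> real) \<Rightarrow> (real \<Rightarrow> real) \<Rightarrow> nat \<Rightarrow> real \<Rightarrow> real \<Rightarrow> nat
     \<Rightarrow> (real \<Rightarrow> real) \<Rightarrow> bool" where
  "fe_solution a c f k \<alpha> \<epsilon> N v \<longleftrightarrow>
     v \<in> fe_space k \<alpha> \<epsilon> N \<and>
     (\<forall>w\<in>fe_space k \<alpha> \<epsilon> N. bilinear a c \<epsilon> v w = L2_inner f w)"

end

theory Submission
  imports Defs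
begin

text \<open>
  Write \<open>t = sqrt \<epsilon> + \<bar>x\<bar>\<close>. The error is split as \<open>u - u\<^sub>N = (u - u\<^sub>I) + (u\<^sub>I - u\<^sub>N)\<close> with a piecewise polynomial \<open>u\<^sub>I\<close>
  from the trial space. Everything rests on the pointwise estimates
  \<open>\<bar>u - u\<^sub>I\<bar> \<le> C N powr (- k)\<close> and \<open>t \<bar>u' - u\<^sub>I'\<bar> \<le> C N powr (- k)\<close>, uniformly in \<open>\<epsilon>\<close>.

  Why they suffice: put \<open>z = u\<^sub>I - u\<^sub>N\<close>. The bilinear form at \<open>(u - u\<^sub>N, z)\<close> vanishes by Galerkin orthogonality, and
  the condition \<open>c - a'/2 \<ge> \<gamma>\<close> makes the form coercive, so the energy norm of \<open>z\<close> is bounded by the terms that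
  involve \<open>u - u\<^sub>I\<close>. The factor \<open>t\<close> is the right weight for the derivative because it dominates both
  \<open>sqrt \<epsilon>\<close>, needed in the diffusion term, and \<open>\<bar>x\<bar>\<close>, needed in the convection term, since \<open>\<bar>a x\<bar> \<le> A \<bar>x\<bar>\<close>
  at a simple turning point. All of this is one pointwise inequality, \<open>energy_density_estimate\<close>, which is
  integrated in \<open>galerkin_error_bound\<close>.

  Why they hold: in the variable \<open>t powr \<alpha>\<close> the mesh is equidistant with step \<open>\<kappa> = O(1/N)\<close>, so an interval at \<open>t\<close>
  has length \<open>h = O(t powr (1 - \<alpha>) / N)\<close> as long as \<open>t\<close> varies on it by a bounded factor only. By the a priori bounds
  the derivative of order \<open>k + 1\<close> is \<open>O(t powr (lam - k - 1))\<close>. Approximation of degree \<open>k\<close> therefore gives a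
  weighted error of the order \<open>t h ^ k t powr (lam - k - 1) = N powr (- k) t powr (lam - \<alpha> k)\<close>, and \<open>lam \<ge> \<alpha> k\<close>. The
  only intervals on which \<open>t\<close> varies too much are the two at the origin, and only if \<open>sqrt \<epsilon> powr \<alpha>\<close> is below the step \<open>\<kappa>\<close>. On
  these \<open>t = O(N powr (- 1/\<alpha>))\<close>, so that \<open>t\<close> and \<open>t powr lam\<close> are \<open>O(N powr (- k))\<close>, and linear interpolation of the
  nearly constant \<open>u\<close> is good enough. The two cases are treated in \<open>local_approximation\<close>.
\<close>

section \<open>Derivatives within the closed interval\<close>

lemma Cn_has_derivative:
  assumes "Cn m g" "i < m" "x \<in> {-1..1}"
  shows "(iter_deriv i g has_real_derivative iter_deriv (Suc i) g x) (at x within {-1..1})"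
proof -
  have "iter_deriv i g differentiable (at x within {-1..1})"
    using assms by (auto simp: Cn_def)
  then show ?thesis
    by (simp add: has_real_derivative_iff_has_vector_derivative vector_derivative_works)
qed

lemma Cn_continuous:
  assumes "Cn m g" "i \<le> m"
  shows "continuous_on {-1..1} (iter_deriv i g)"
proof (cases "i = m")
  case True
  then show ?thesis using assms by (simp add: Cn_def)
next
  case False
  then show ?thesis
    using Cn_has_derivative[OF assms(1), of i] assms(2)
    by (intro DERIV_continuous_on[where D = "iter_deriv (Suc i) g"]) (auto simp del: iter_deriv.simps)
qed

lemma has_derivative_interior:
  fixes x :: real
  assumes "(g has_real_derivative D) (at x within {l..r})" "l < x" "x < r"
  shows "(g has_real_derivative D) (at x)"
  using assms at_within_Icc_at[of l x r] by simp

section \<open>Integrals of piecewise continuous functions\<close>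

text \<open>
  Every integrand below is a product of data, of finite element functions and of their derivatives,
  hence continuous and bounded off some finite set. The exceptional set is existentially quantified
  so that the class is closed under products without any bookkeeping of breakpoints.
\<close>
definition pw_continuous :: "(real \<Rightarrow> real) \<Rightarrow> bool" where
  "pw_continuous g \<longleftrightarrow>
     (\<exists>F. finite F \<and> continuous_on ({-1<..<1} - F) g \<and> bounded (g ` ({-1<..<1} - F)))"

abbreviation integral_I :: "(real \<Rightarrow> real) \<Rightarrow> real" where
  "integral_I g \<equiv> (LINT x:{-1<..<1}|lborel. g x)"

lemma pw_continuousI:
  assumes "finite F" "continuous_on ({-1<..<1} - F) g" "\<And>x. x \<in> {-1<..<1} - F \<Longrightarrow> \<bar>g x\<bar> \<le> B"
  shows "pw_continuous g"
proof -
  have "bounded (g ` ({-1<..<1} - F))"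
    unfolding bounded_iff using assms(3) by (intro exI[of _ B]) auto
  with assms show ?thesis unfolding pw_continuous_def by blast
qed

lemma pw_continuousE:
  assumes "pw_continuous g"
  obtains F B where "finite F" "continuous_on ({-1<..<1} - F) g"
    "\<And>x. x \<in> {-1<..<1} - F \<Longrightarrow> \<bar>g x\<bar> \<le> B"
  using assms unfolding pw_continuous_def bounded_iff by (metis imageI real_norm_def)

lemma pw_continuous_continuous:
  assumes "continuous_on {-1..1} g"
  shows "pw_continuous g"
proof -
  have "bounded (g ` {-1..1})"
    using assms by (intro compact_imp_bounded compact_continuous_image) auto
  then have "bounded (g ` ({-1<..<1} - {}))"
    by (rule bounded_subset) auto
  moreover have "continuous_on ({-1<..<1} - {}) g"
    using assms by (rule continuous_on_subset) auto
  ultimately show ?thesis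
    unfolding pw_continuous_def by blast
qed

lemma pw_continuous_binary:
  assumes "pw_continuous g" "pw_continuous h"
    and cont: "\<And>S. continuous_on S g \<Longrightarrow> continuous_on S h \<Longrightarrow> continuous_on S (\<lambda>x. op (g x) (h x))"
    and bd: "\<And>A B. \<exists>C. \<forall>y z. \<bar>y\<bar> \<le> A \<longrightarrow> \<bar>z\<bar> \<le> B \<longrightarrow> \<bar>op y z\<bar> \<le> C"
  shows "pw_continuous (\<lambda>x. op (g x) (h x))"
proof -
  obtain F A where F: "finite F" "continuous_on ({-1<..<1} - F) g"
    and A: "\<And>x. x \<in> {-1<..<1} - F \<Longrightarrow> \<bar>g x\<bar> \<le> A"
    using pw_continuousE[OF assms(1)] by metis
  obtain G B where G: "finite G" "continuous_on ({-1<..<1} - G) h"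
    and B: "\<And>x. x \<in> {-1<..<1} - G \<Longrightarrow> \<bar>h x\<bar> \<le> B"
    using pw_continuousE[OF assms(2)] by metis
  obtain C where C: "\<forall>y z. \<bar>y\<bar> \<le> A \<longrightarrow> \<bar>z\<bar> \<le> B \<longrightarrow> \<bar>op y z\<bar> \<le> C" using bd by blast
  show ?thesis
  proof (rule pw_continuousI[of "F \<union> G" _ C])
    show "continuous_on ({-1<..<1} - (F \<union> G)) (\<lambda>x. op (g x) (h x))"
      by (intro cont continuous_on_subset[OF F(2)] continuous_on_subset[OF G(2)]) auto
  qed (use F G A B C in auto)
qed

lemma pw_continuous_const: "pw_continuous (\<lambda>x. d)"
  by (rule pw_continuous_continuous) auto

lemma pw_continuous_add:
  assumes "pw_continuous g" "pw_continuous h"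
  shows "pw_continuous (\<lambda>x. g x + h x)"
proof (rule pw_continuous_binary[OF assms, where op = "(+)"])
  fix A B :: real
  show "\<exists>C. \<forall>y z. \<bar>y\<bar> \<le> A \<longrightarrow> \<bar>z\<bar> \<le> B \<longrightarrow> \<bar>y + z\<bar> \<le> C"
    by (rule exI[of _ "A + B"]) auto
qed (auto intro: continuous_intros)

lemma pw_continuous_mult:
  assumes "pw_continuous g" "pw_continuous h"
  shows "pw_continuous (\<lambda>x. g x * h x)"
proof (rule pw_continuous_binary[OF assms, where op = "(*)"])
  fix A B :: real
  show "\<exists>C. \<forall>y z. \<bar>y\<bar> \<le> A \<longrightarrow> \<bar>z\<bar> \<le> B \<longrightarrow> \<bar>y * z\<bar> \<le> C"
    by (rule exI[of _ "A * B"]) (auto simp: abs_mult intro!: mult_mono)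
qed (auto intro: continuous_intros)

lemma pw_continuous_diff:
  assumes "pw_continuous g" "pw_continuous h"
  shows "pw_continuous (\<lambda>x. g x - h x)"
  using pw_continuous_add[OF assms(1) pw_continuous_mult[OF pw_continuous_const[of "-1"] assms(2)]]
  by simp

lemma pw_continuous_power2:
  assumes "pw_continuous g"
  shows "pw_continuous (\<lambda>x. (g x)\<^sup>2)"
  using pw_continuous_mult[OF assms assms] by (simp add: power2_eq_square)

lemmas pw_intros = pw_continuous_add pw_continuous_mult pw_continuous_diff pw_continuous_const
  pw_continuous_power2

lemma AE_not_in_finite:
  assumes "finite (F :: real set)"
  shows "AE x in lborel. x \<notin> F"
  using assms finite_imp_null_set_lborel AE_not_in by blast

text \<open>
  Off the exceptional set the function is a bounded continuous function on an open set of finite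
  measure; the exceptional set itself is a null set.
\<close>
lemma pw_continuous_integrable:
  assumes "pw_continuous g"
  shows "set_integrable lborel {-1<..<1} g"
proof -
  obtain F A where F: "finite F" "continuous_on ({-1<..<1} - F) g"
    and A: "\<And>x. x \<in> {-1<..<1} - F \<Longrightarrow> \<bar>g x\<bar> \<le> A"
    using pw_continuousE[OF assms] by metis
  let ?S = "{-1<..<1} - F"
  have m: "set_borel_measurable lborel ?S g"
  proof -
    have "open ?S" using F(1) by (intro open_Diff) (auto intro: finite_imp_closed)
    then have "(\<lambda>x. indicator ?S x *\<^sub>R g x) \<in> borel_measurable borel"
      using F(2) by (intro borel_measurable_continuous_on_indicator) auto
    then show ?thesis by (simp add: set_borel_measurable_def)
  qed
  have "closed F" using F(1) by (rule finite_imp_closed)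
  then have S: "?S \<in> sets lborel" by simp
  have i1: "set_integrable lborel ?S g"
    unfolding set_integrable_def
  proof (rule integrableI_bounded_set[of ?S _ _ A])
    show "(\<lambda>x. indicator ?S x *\<^sub>R g x) \<in> borel_measurable lborel"
      using m by (simp add: set_borel_measurable_def)
    have "emeasure lborel ?S \<le> emeasure lborel {-1<..<1::real}"
      by (rule emeasure_mono) auto
    then show "emeasure lborel ?S < \<infinity>"
      by (simp add: order_le_less_trans)
  qed (use A S in \<open>auto simp: indicator_def\<close>)
  have i2: "set_integrable lborel F g"
  proof -
    have "integrable lborel (\<lambda>x. indicator F x *\<^sub>R g x) \<longleftrightarrow> integrable lborel (\<lambda>x::real. 0::real)"
    proof (rule integrable_cong_AE)
      have "(\<lambda>x. indicator F x *\<^sub>R g x) = (\<lambda>x. \<Sum>y\<in>F. indicator {y} x *\<^sub>R g y)"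
        using F(1) by (auto simp: fun_eq_iff indicator_def if_distrib sum.delta cong: if_cong)
      then show "(\<lambda>x. indicator F x *\<^sub>R g x) \<in> borel_measurable lborel" by simp
      show "AE x in lborel. indicator F x *\<^sub>R g x = 0"
        using AE_not_in_finite[OF F(1)] by eventually_elim auto
    qed auto
    then show ?thesis by (simp add: set_integrable_def)
  qed
  have "set_integrable lborel (?S \<union> F) g"
    using i1 i2 S \<open>closed F\<close> by (intro set_integrable_Un) auto
  then show ?thesis
    by (rule set_integrable_subset) auto
qed

lemma integral_I_mono:
  assumes "pw_continuous g" "pw_continuous h" "finite F"
    and "\<And>x. x \<in> {-1<..<1} - F \<Longrightarrow> g x \<le> h x"
  shows "integral_I g \<le> integral_I h"
  unfolding set_lebesgue_integral_def
proof (rule integral_mono_AE)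
  show "AE x in lborel. indicator {-1<..<1} x *\<^sub>R g x \<le> indicator {-1<..<1} x *\<^sub>R h x"
    using AE_not_in_finite[OF assms(3)] by eventually_elim (use assms(4) in \<open>auto simp: indicator_def\<close>)
qed (use pw_continuous_integrable[OF assms(1)] pw_continuous_integrable[OF assms(2)] in
      \<open>auto simp: set_integrable_def\<close>)

lemma integral_I_cong:
  assumes "pw_continuous g" "pw_continuous h" "finite F"
    and "\<And>x. x \<in> {-1<..<1} - F \<Longrightarrow> g x = h x"
  shows "integral_I g = integral_I h"
  using integral_I_mono[OF assms(1-3)] integral_I_mono[OF assms(2,1,3)] assms(4)
  by (simp add: order_antisym)

lemma integral_I_add:
  assumes "pw_continuous g" "pw_continuous h"
  shows "integral_I (\<lambda>x. g x + h x) = integral_I g + integral_I h"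
  using assms by (intro set_integral_add pw_continuous_integrable)

lemma integral_I_diff:
  assumes "pw_continuous g" "pw_continuous h"
  shows "integral_I (\<lambda>x. g x - h x) = integral_I g - integral_I h"
  using assms by (intro set_integral_diff pw_continuous_integrable)

lemma integral_I_const: "integral_I (\<lambda>x. d) = 2 * d"
  by (simp add: set_lebesgue_integral_def)

text \<open>
  Because \<^term>\<open>v\<close> is continuous across the exceptional points, no jump terms arise.
\<close>
lemma integral_I_FTC:
  assumes "continuous_on {-1..1} v" "finite F" "pw_continuous g"
    and "\<And>x. x \<in> {-1<..<1} - F \<Longrightarrow> (v has_real_derivative g x) (at x)"
  shows "integral_I g = v 1 - v (-1)"
proof -
  have "(g has_integral v 1 - v (-1)) {-1..1}"
    using assms by (intro fundamental_theorem_of_calculus_interior_strong[of F])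
      (auto simp: has_real_derivative_iff_has_vector_derivative)
  then have "(g has_integral v 1 - v (-1)) {-1<..<1}"
    using has_integral_Icc_iff_Ioo by blast
  moreover have "(g has_integral integral_I g) {-1<..<1}"
    using pw_continuous_integrable[OF assms(3)]
    using set_borel_integral_eq_integral[of "{-1<..<1}" g] by (simp add: has_integral_iff)
  ultimately show ?thesis using has_integral_unique by blast
qed

section \<open>Piecewise smooth functions and the weak formulation\<close>

text \<open>
  The function itself is continuous on the closed interval; at the finitely many exceptional points
  \<^term>\<open>deriv v\<close> may take arbitrary values.
\<close>
definition pw_C1 :: "(real \<Rightarrow> real) \<Rightarrow> bool" where
  "pw_C1 v \<longleftrightarrow> continuous_on {-1..1} v \<and> pw_continuous (deriv v) \<and>
     (\<exists>F. finite F \<and> (\<forall>x\<in>{-1<..<1} - F. (v has_real_derivative deriv v x) (at x)))"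

lemma pw_C1I:
  assumes "continuous_on {-1..1} v" "finite F"
    and D: "\<And>x. x \<in> {-1<..<1} - F \<Longrightarrow> (v has_real_derivative g x) (at x)"
    and g: "pw_continuous g"
  shows "pw_C1 v"
proof -
  have eq: "deriv v x = g x" if "x \<in> {-1<..<1} - F" for x
    using D[OF that] by (rule DERIV_imp_deriv)
  obtain G where G: "finite G" "continuous_on ({-1<..<1} - G) g" "bounded (g ` ({-1<..<1} - G))"
    using g unfolding pw_continuous_def by blast
  have "continuous_on ({-1<..<1} - (F \<union> G)) (deriv v)"
    by (rule continuous_on_eq[OF continuous_on_subset[OF G(2)]]) (use eq in auto)
  moreover have "bounded (deriv v ` ({-1<..<1} - (F \<union> G)))"
    by (rule bounded_subset[OF G(3)]) (use eq in auto)
  ultimately have "pw_continuous (deriv v)"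
    unfolding pw_continuous_def using \<open>finite F\<close> G(1) by blast
  then show ?thesis
    unfolding pw_C1_def using assms eq by metis
qed

lemma pw_C1_pw_continuous:
  assumes "pw_C1 v"
  shows "pw_continuous v" "pw_continuous (deriv v)"
  using assms by (auto simp: pw_C1_def intro: pw_continuous_continuous)

lemma pw_C1_diff:
  assumes "pw_C1 v" "pw_C1 w"
  shows "pw_C1 (\<lambda>x. v x - w x)"
    and "\<exists>F. finite F \<and> (\<forall>x\<in>{-1<..<1} - F. deriv (\<lambda>x. v x - w x) x = deriv v x - deriv w x)"
proof -
  obtain F where F: "finite F" "\<forall>x\<in>{-1<..<1} - F. (v has_real_derivative deriv v x) (at x)"
    using assms(1) by (auto simp: pw_C1_def)
  obtain G where G: "finite G" "\<forall>x\<in>{-1<..<1} - G. (w has_real_derivative deriv w x) (at x)"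
    using assms(2) by (auto simp: pw_C1_def)
  have D: "((\<lambda>x. v x - w x) has_real_derivative deriv v x - deriv w x) (at x)"
    if "x \<in> {-1<..<1} - (F \<union> G)" for x
    using that F G by (intro DERIV_diff) auto
  show "pw_C1 (\<lambda>x. v x - w x)"
    using assms F(1) G(1)
    by (intro pw_C1I[of _ "F \<union> G", OF _ _ D]) (auto simp: pw_C1_def intro!: continuous_intros pw_intros)
  show "\<exists>F. finite F \<and> (\<forall>x\<in>{-1<..<1} - F. deriv (\<lambda>x. v x - w x) x = deriv v x - deriv w x)"
    using F(1) G(1) DERIV_imp_deriv[OF D] by (intro exI[of _ "F \<union> G"]) auto
qed

lemma bilinear_eq_integral:
  assumes "pw_continuous a" "pw_continuous c" "pw_C1 v" "pw_C1 w"
  shows "bilinear a c \<epsilon> v w =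
    integral_I (\<lambda>x. \<epsilon> * deriv v x * deriv w x + a x * deriv v x * w x + c x * v x * w x)"
proof -
  note i = pw_C1_pw_continuous[OF assms(3)] pw_C1_pw_continuous[OF assms(4)] assms(1,2)
  have "\<epsilon> * L2_inner (deriv v) (deriv w) = integral_I (\<lambda>x. \<epsilon> * deriv v x * deriv w x)"
    unfolding L2_inner_def set_integral_mult_right[symmetric] by (simp add: mult.assoc)
  then show ?thesis
    unfolding bilinear_def L2_inner_def
    by (simp add: integral_I_add pw_intros i)
qed

text \<open>
  Integration by parts in the form \<open>\<integral>(u'w)' = 0\<close>, which only asks the test function to be piecewise
  smooth and to vanish at the end points; this is what gives Galerkin orthogonality.
\<close>
lemma weak_formulation:
  assumes u: "bvp_solution a c f \<epsilon> u" "Cn 2 u"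
    and cont: "continuous_on {-1..1} a" "continuous_on {-1..1} c" "continuous_on {-1..1} f"
    and w: "pw_C1 w" "w (-1) = 0" "w 1 = 0"
  shows "pw_C1 u" "bilinear a c \<epsilon> u w = L2_inner f w"
proof -
  let ?d = "iter_deriv 1 u" and ?dd = "iter_deriv 2 u"
  have D1: "(u has_real_derivative ?d x) (at x)" if "x \<in> {-1<..<1}" for x
    using Cn_has_derivative[OF u(2), of 0 x] that by (auto dest: has_derivative_interior)
  have D2: "(?d has_real_derivative ?dd x) (at x)" if "x \<in> {-1<..<1}" for x
    using Cn_has_derivative[OF u(2), of 1 x] that
    by (auto simp: numeral_2_eq_2 dest: has_derivative_interior)
  have cd: "continuous_on {-1..1} ?d" "continuous_on {-1..1} ?dd" "continuous_on {-1..1} u"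
    using Cn_continuous[OF u(2), of 1] Cn_continuous[OF u(2), of 2] Cn_continuous[OF u(2), of 0]
    by auto
  have e1: "deriv u x = ?d x" if "x \<in> {-1<..<1}" for x
    using D1[OF that] by (rule DERIV_imp_deriv)
  have e2: "deriv (deriv u) x = ?dd x" if "x \<in> {-1<..<1}" for x
  proof (rule DERIV_imp_deriv)
    show "(deriv u has_real_derivative ?dd x) (at x)"
      by (rule has_field_derivative_transform_within_open[OF D2[OF that], of "{-1<..<1}"])
         (use that e1 in auto)
  qed
  have ode: "- \<epsilon> * ?dd x + a x * ?d x + c x * u x = f x" if "x \<in> {-1<..<1}" for x
    using u(1) that unfolding bvp_solution_def e1[OF that, symmetric] e2[OF that, symmetric] by blast
  show pu: "pw_C1 u"
    using cd D1 by (intro pw_C1I[of u "{}" ?d]) (auto intro: pw_continuous_continuous)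
  obtain F where F: "finite F" "\<forall>x\<in>{-1<..<1} - F. (w has_real_derivative deriv w x) (at x)"
    using w(1) by (auto simp: pw_C1_def)
  note i = pw_C1_pw_continuous[OF pu] pw_C1_pw_continuous[OF w(1)]
    cont[THEN pw_continuous_continuous] cd[THEN pw_continuous_continuous]
  \<comment> \<open>The flux \<open>u'\<close> is represented by the one-sided derivative, which is continuous up to the end points.\<close>
  have "integral_I (\<lambda>x. ?dd x * w x + deriv w x * ?d x) = ?d 1 * w 1 - ?d (-1) * w (-1)"
  proof (rule integral_I_FTC[OF _ F(1)])
    show "continuous_on {-1..1} (\<lambda>x. ?d x * w x)"
      using w(1) cd by (auto simp: pw_C1_def intro!: continuous_intros)
    show "((\<lambda>x. ?d x * w x) has_real_derivative ?dd x * w x + deriv w x * ?d x) (at x)"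
      if "x \<in> {-1<..<1} - F" for x
      using that F D2 by (intro DERIV_mult) auto
  qed (intro pw_intros i)
  then have 0: "integral_I (\<lambda>x. ?dd x * w x + deriv w x * ?d x) = 0" using w by simp
  have "bilinear a c \<epsilon> u w =
      integral_I (\<lambda>x. \<epsilon> * deriv u x * deriv w x + a x * deriv u x * w x + c x * u x * w x)"
    by (intro bilinear_eq_integral pu w i)
  also have "\<dots> = integral_I (\<lambda>x. \<epsilon> * (?dd x * w x + deriv w x * ?d x) + f x * w x)"
  proof (rule integral_I_cong[of _ _ "{}"])
    fix x :: real assume x: "x \<in> {-1<..<1} - {}"
    then have "f x = - \<epsilon> * ?dd x + a x * ?d x + c x * u x" using ode by auto
    moreover have "deriv u x = ?d x" using e1 x by auto
    ultimately show "\<epsilon> * deriv u x * deriv w x + a x * deriv u x * w x + c x * u x * w x =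
        \<epsilon> * (?dd x * w x + deriv w x * ?d x) + f x * w x"
      by (simp only:) (simp add: algebra_simps del: iter_deriv.simps One_nat_def)
  qed (auto intro!: pw_intros i simp del: iter_deriv.simps One_nat_def)
  also have "\<dots> = integral_I (\<lambda>x. f x * w x)"
  proof -
    have "integral_I (\<lambda>x. \<epsilon> * (?dd x * w x + deriv w x * ?d x)) = 0" using 0 by simp
    then show ?thesis by (subst integral_I_add) (auto intro!: pw_intros i simp del: iter_deriv.simps One_nat_def)
  qed
  finally show "bilinear a c \<epsilon> u w = L2_inner f w" by (simp add: L2_inner_def)
qed

section \<open>Stability of the Galerkin solution\<close>

lemma energy_norm_square:
  assumes "pw_C1 v" "0 < \<epsilon>"
  shows "(energy_norm \<epsilon> v)\<^sup>2 = integral_I (\<lambda>x. \<epsilon> * (deriv v x)\<^sup>2 + (v x)\<^sup>2)"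
proof -
  note i = pw_C1_pw_continuous[OF assms(1)]
  have sq: "(L2_norm g)\<^sup>2 = integral_I (\<lambda>x. (g x)\<^sup>2)" if "pw_continuous g" for g
  proof -
    have "integral_I (\<lambda>x. 0) \<le> integral_I (\<lambda>x. (g x)\<^sup>2)"
      by (rule integral_I_mono[of _ _ "{}"]) (auto intro!: pw_intros that)
    then show ?thesis
      by (simp add: L2_norm_def L2_inner_def power2_eq_square)
  qed
  have "0 \<le> \<epsilon> * (L2_norm (deriv v))\<^sup>2 + (L2_norm v)\<^sup>2" using assms(2) by simp
  then have "(energy_norm \<epsilon> v)\<^sup>2 = \<epsilon> * (L2_norm (deriv v))\<^sup>2 + (L2_norm v)\<^sup>2"
    by (simp add: energy_norm_def)
  also have "\<dots> = integral_I (\<lambda>x. \<epsilon> * (deriv v x)\<^sup>2 + (v x)\<^sup>2)"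
    by (simp add: integral_I_add pw_intros i sq)
  finally show ?thesis .
qed

lemma young_lower:
  fixes x y d :: real
  assumes "0 < d"
  shows "- (x\<^sup>2 / d) - d / 4 * y\<^sup>2 \<le> x * y"
proof -
  have "0 \<le> (x + d / 2 * y)\<^sup>2 / d" using assms by simp
  also have "\<dots> = x\<^sup>2 / d + x * y + d / 4 * y\<^sup>2"
    using assms by (simp add: power2_eq_square field_simps)
  finally show ?thesis by simp
qed

text \<open>
  The pointwise core of the stability estimate. At a fixed point, \<open>h\<close> stands for the approximation
  error \<open>u - u\<^sub>I\<close> and \<open>z\<close> for \<open>u\<^sub>I - u\<^sub>N\<close>, so that \<open>h + z\<close> is the error \<open>u - u\<^sub>N\<close>, and \<open>X\<close> stands for \<open>\<bar>x\<bar>\<close>.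
  In the bracket, the first summand is the integrand of the bilinear form at \<open>(u - u\<^sub>N, z)\<close>; the
  subtracted one is the derivative of \<open>a z\<^sup>2 / 2\<close>. Both integrate to zero, so integrating this inequality
  bounds the energy norm by a multiple of \<open>\<delta>\<close>. The subtraction turns the convection term \<open>a z' z\<close> into \<open>- a' z\<^sup>2 / 2\<close>, whence
  the coefficient \<open>c - a' / 2 \<ge> \<gamma>\<close>, and Young's inequality absorbs the mixed terms.

  The weight \<open>sqrt \<epsilon> + X\<close> on \<open>h'\<close> serves the diffusion term, through \<open>\<epsilon> h'\<^sup>2 \<le> \<delta>\<^sup>2\<close>, and the convection term,
  through \<open>\<bar>a h'\<bar> \<le> A X \<bar>h'\<bar>\<close>, where the turning point at the origin enters.
\<close>
lemma energy_density_estimate: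
  fixes \<epsilon> \<gamma> \<delta> X A a a' c h h' z z' :: real
  assumes "0 < \<epsilon>" "0 < \<gamma>" "0 \<le> \<delta>"
    and coerc: "\<gamma> \<le> c - a' / 2"
    and a: "\<bar>a\<bar> \<le> A * X" and c: "\<bar>c\<bar> \<le> A" and "0 \<le> X" "0 \<le> A"
    and h: "\<bar>h\<bar> \<le> \<delta>" and h': "(sqrt \<epsilon> + X) * \<bar>h'\<bar> \<le> \<delta>"
  defines "m \<equiv> min (1/2) (\<gamma>/2)"
  defines "Q \<equiv> 1/2 + 2 * A\<^sup>2 / \<gamma>"
  shows "\<epsilon> * (h' + z')\<^sup>2 + (h + z)\<^sup>2 \<le> (4 + 2 * Q / m) * \<delta>\<^sup>2 +
     2 / m * ((\<epsilon> * (h' + z') * z' + a * (h' + z') * z + c * (h + z) * z)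
        - (a' / 2 * z\<^sup>2 + a * z * z'))"
    (is "_ \<le> _ + 2 / m * ?J")
proof -
  have m: "0 < m" "m \<le> 1/2" "m \<le> \<gamma>/2" using assms(2) by (auto simp: m_def)
  have s: "sqrt \<epsilon> * \<bar>h'\<bar> \<le> \<delta>" "X * \<bar>h'\<bar> \<le> \<delta>"
  proof -
    have "0 \<le> sqrt \<epsilon> * \<bar>h'\<bar>" "0 \<le> X * \<bar>h'\<bar>" using assms by auto
    then show "sqrt \<epsilon> * \<bar>h'\<bar> \<le> \<delta>" "X * \<bar>h'\<bar> \<le> \<delta>" using h' by (auto simp: algebra_simps)
  qed
  have "(sqrt \<epsilon> * \<bar>h'\<bar>)\<^sup>2 \<le> \<delta>\<^sup>2" using s(1) assms(1) by (intro power_mono) auto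
  then have e1: "\<epsilon> * h'\<^sup>2 \<le> \<delta>\<^sup>2" using assms(1) by (simp add: power_mult_distrib)
  have e2: "h\<^sup>2 \<le> \<delta>\<^sup>2" using power_mono[OF h, of 2] by simp
  have "\<bar>a * h'\<bar> \<le> A * X * \<bar>h'\<bar>" unfolding abs_mult using a by (intro mult_right_mono) auto
  also have "\<dots> \<le> A * \<delta>" using s(2) assms(8) by (simp add: mult.assoc mult_left_mono)
  finally have "\<bar>a * h'\<bar> \<le> A * \<delta>" .
  from power_mono[OF this, of 2] have e3: "(a * h')\<^sup>2 / \<gamma> \<le> A\<^sup>2 * \<delta>\<^sup>2 / \<gamma>"
    using assms(2) by (simp add: power_mult_distrib divide_right_mono)
  have "\<bar>c * h\<bar> \<le> A * \<delta>" unfolding abs_mult using c h assms(8) by (intro mult_mono) auto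
  from power_mono[OF this, of 2] have e4: "(c * h)\<^sup>2 / \<gamma> \<le> A\<^sup>2 * \<delta>\<^sup>2 / \<gamma>"
    using assms(2) by (simp add: power_mult_distrib divide_right_mono)
  have y1: "- ((a * h')\<^sup>2 / \<gamma>) - \<gamma> / 4 * z\<^sup>2 \<le> a * h' * z" by (rule young_lower[OF assms(2)])
  have y2: "- ((c * h)\<^sup>2 / \<gamma>) - \<gamma> / 4 * z\<^sup>2 \<le> c * h * z" by (rule young_lower[OF assms(2)])
  \<comment> \<open>Half of \<open>\<epsilon> z'\<^sup>2\<close> is spent here, and half of \<open>\<gamma> z\<^sup>2\<close> on the two previous estimates; hence the constant \<open>m\<close>.\<close>
  have y3: "- (\<epsilon> * h'\<^sup>2) / 2 - \<epsilon> * z'\<^sup>2 / 2 \<le> \<epsilon> * h' * z'"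
  proof -
    have "0 \<le> \<epsilon> * (h' + z')\<^sup>2 / 2" using assms(1) by simp
    then show ?thesis by (simp add: power2_eq_square algebra_simps)
  qed
  have y4: "\<gamma> * z\<^sup>2 \<le> (c - a' / 2) * z\<^sup>2" using coerc by (intro mult_right_mono) auto
  have "?J = \<epsilon> * h' * z' + \<epsilon> * z'\<^sup>2 + a * h' * z + c * h * z + (c - a' / 2) * z\<^sup>2"
    by (simp add: power2_eq_square algebra_simps)
  moreover have "m * (\<epsilon> * z'\<^sup>2) \<le> 1/2 * (\<epsilon> * z'\<^sup>2)"
    using m assms(1) by (intro mult_right_mono) auto
  moreover have "m * z\<^sup>2 \<le> \<gamma>/2 * z\<^sup>2" using m by (intro mult_right_mono) auto
  moreover have "Q * \<delta>\<^sup>2 = \<delta>\<^sup>2 / 2 + A\<^sup>2 * \<delta>\<^sup>2 / \<gamma> + A\<^sup>2 * \<delta>\<^sup>2 / \<gamma>"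
    by (simp add: Q_def algebra_simps)
  ultimately have "m * (\<epsilon> * z'\<^sup>2 + z\<^sup>2) \<le> ?J + Q * \<delta>\<^sup>2"
    using y1 y2 y3 y4 e1 e3 e4 by (simp add: algebra_simps)
  then have "2 * (\<epsilon> * z'\<^sup>2 + z\<^sup>2) \<le> 2 / m * (?J + Q * \<delta>\<^sup>2)"
    using m(1) by (simp add: field_simps)
  moreover have "\<epsilon> * (h' + z')\<^sup>2 + (h + z)\<^sup>2 \<le> 2 * (\<epsilon> * h'\<^sup>2 + h\<^sup>2) + 2 * (\<epsilon> * z'\<^sup>2 + z\<^sup>2)"
  proof -
    \<comment> \<open>The parallelogram identity.\<close>
    have "0 \<le> \<epsilon> * (h' - z')\<^sup>2 + (h - z)\<^sup>2" using assms(1) by simp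
    then show ?thesis by (simp add: power2_eq_square algebra_simps)
  qed
  moreover have "2 * (\<epsilon> * h'\<^sup>2 + h\<^sup>2) \<le> 4 * \<delta>\<^sup>2" using e1 e2 by simp
  moreover have "2 / m * (?J + Q * \<delta>\<^sup>2) = 2 / m * ?J + 2 * Q / m * \<delta>\<^sup>2"
    by (simp add: distrib_left)
  ultimately show ?thesis by (simp add: distrib_right)
qed

text \<open>
  The Galerkin error is controlled by any approximant \<open>u\<^sub>I\<close> from the trial space, measured in the maximum
  norm for the values and in the maximum norm with weight \<open>sqrt \<epsilon> + \<bar>x\<bar>\<close> for the derivatives. The factor
  depends on \<open>\<gamma>\<close> and \<open>A\<close> only.
\<close>
lemma galerkin_error_bound:
  assumes \<epsilon>: "0 < \<epsilon>" and \<gamma>: "0 < \<gamma>" and \<delta>: "0 \<le> \<delta>" and A: "0 \<le> A"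
    and a: "Cn 1 a" "\<And>x. x \<in> {-1..1} \<Longrightarrow> \<bar>a x\<bar> \<le> A * \<bar>x\<bar>"
    and c: "continuous_on {-1..1} c" "\<And>x. x \<in> {-1..1} \<Longrightarrow> \<bar>c x\<bar> \<le> A"
    and coerc: "\<And>x. x \<in> {-1..1} \<Longrightarrow> \<gamma> \<le> c x - iter_deriv 1 a x / 2"
    and pw: "pw_C1 u" "pw_C1 u\<^sub>N" "pw_C1 u\<^sub>I"
    and bc: "u\<^sub>N (-1) = 0" "u\<^sub>N 1 = 0" "u\<^sub>I (-1) = 0" "u\<^sub>I 1 = 0"
    and orth: "bilinear a c \<epsilon> u (\<lambda>x. u\<^sub>I x - u\<^sub>N x) = bilinear a c \<epsilon> u\<^sub>N (\<lambda>x. u\<^sub>I x - u\<^sub>N x)"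
    and F: "finite F"
    and h: "\<And>x. x \<in> {-1<..<1} - F \<Longrightarrow> \<bar>u x - u\<^sub>I x\<bar> \<le> \<delta>"
    and h': "\<And>x. x \<in> {-1<..<1} - F \<Longrightarrow> (sqrt \<epsilon> + \<bar>x\<bar>) * \<bar>deriv u x - deriv u\<^sub>I x\<bar> \<le> \<delta>"
  shows "energy_norm \<epsilon> (\<lambda>x. u x - u\<^sub>N x) \<le>
    sqrt (8 + 4 * (1/2 + 2 * A\<^sup>2 / \<gamma>) / min (1/2) (\<gamma>/2)) * \<delta>"
proof -
  define m where "m = min (1/2) (\<gamma>/2)"
  define Q where "Q = 1/2 + 2 * A\<^sup>2 / \<gamma>"
  define e where "e = (\<lambda>x. u x - u\<^sub>N x)"
  define z where "z = (\<lambda>x. u\<^sub>I x - u\<^sub>N x)"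
  let ?a' = "iter_deriv 1 a"
  have pe: "pw_C1 e" and pz: "pw_C1 z"
    unfolding e_def z_def by (intro pw_C1_diff pw)+
  obtain G where G: "finite G" "\<forall>x\<in>{-1<..<1} - G. deriv e x = deriv u x - deriv u\<^sub>N x"
    using pw_C1_diff(2)[OF pw(1,2)] unfolding e_def by blast
  obtain H where H: "finite H" "\<forall>x\<in>{-1<..<1} - H. deriv z x = deriv u\<^sub>I x - deriv u\<^sub>N x"
    using pw_C1_diff(2)[OF pw(3,2)] unfolding z_def by blast
  obtain Z where Z: "finite Z" "\<forall>x\<in>{-1<..<1} - Z. (z has_real_derivative deriv z x) (at x)"
    using pz unfolding pw_C1_def by blast
  have ca: "continuous_on {-1..1} a" "continuous_on {-1..1} ?a'"
    using Cn_continuous[OF a(1), of 0] Cn_continuous[OF a(1), of 1] by simp_all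
  note i = pw_C1_pw_continuous[OF pe] pw_C1_pw_continuous[OF pz]
    pw_C1_pw_continuous[OF pw(1)] pw_C1_pw_continuous[OF pw(2)]
    ca[THEN pw_continuous_continuous] c(1)[THEN pw_continuous_continuous]
  let ?B = "\<lambda>x. \<epsilon> * deriv e x * deriv z x + a x * deriv e x * z x + c x * e x * z x"
  let ?T = "\<lambda>x. ?a' x / 2 * (z x)\<^sup>2 + a x * z x * deriv z x"
  have iT: "pw_continuous ?T"
    unfolding divide_inverse by (intro pw_intros i)
  \<comment> \<open>Galerkin orthogonality. The derivative \<open>deriv e\<close> is only known to split outside a finite set, hence the comparison of integrals.\<close>
  have B0: "integral_I ?B = 0"
  proof -
    let ?U = "\<lambda>v x. \<epsilon> * deriv v x * deriv z x + a x * deriv v x * z x + c x * v x * z x"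
    have "integral_I ?B = integral_I (\<lambda>x. ?U u x - ?U u\<^sub>N x)"
    proof (rule integral_I_cong[OF _ _ G(1)])
      fix x assume "x \<in> {-1<..<1} - G"
      then have "deriv e x = deriv u x - deriv u\<^sub>N x" "e x = u x - u\<^sub>N x"
        using G(2) by (auto simp: e_def)
      then show "?B x = ?U u x - ?U u\<^sub>N x"
        by (simp only:) (simp add: algebra_simps)
    qed (intro pw_intros i)+
    also have "\<dots> = integral_I (?U u) - integral_I (?U u\<^sub>N)"
      by (intro integral_I_diff pw_intros i)
    also have "\<dots> = bilinear a c \<epsilon> u z - bilinear a c \<epsilon> u\<^sub>N z"
      by (subst (1 2) bilinear_eq_integral) (intro pw pz i refl)+
    also have "\<dots> = 0" using orth by (simp add: z_def)
    finally show ?thesis .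
  qed
  \<comment> \<open>The boundary values of \<open>a z\<^sup>2 / 2\<close> vanish.\<close>
  have T0: "integral_I ?T = 0"
  proof -
    have "integral_I ?T = a 1 / 2 * (z 1)\<^sup>2 - a (-1) / 2 * (z (-1))\<^sup>2"
    proof (rule integral_I_FTC[OF _ Z(1) iT])
      show "continuous_on {-1..1} (\<lambda>x. a x / 2 * (z x)\<^sup>2)"
        using pz ca by (auto simp: pw_C1_def intro!: continuous_intros)
      fix x assume x: "x \<in> {-1<..<1} - Z"
      have "(a has_real_derivative ?a' x) (at x)"
        using Cn_has_derivative[OF a(1), of 0 x] x by (auto dest: has_derivative_interior)
      moreover have "(z has_real_derivative deriv z x) (at x)" using x Z by blast
      ultimately show "((\<lambda>x. a x / 2 * (z x)\<^sup>2) has_real_derivative ?T x) (at x)"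
        by (auto intro!: derivative_eq_intros simp del: iter_deriv.simps One_nat_def)
    qed
    then show ?thesis using bc by (simp add: z_def)
  qed
  have "(energy_norm \<epsilon> e)\<^sup>2 = integral_I (\<lambda>x. \<epsilon> * (deriv e x)\<^sup>2 + (e x)\<^sup>2)"
    by (rule energy_norm_square[OF pe \<epsilon>])
  also have "\<dots> \<le> integral_I (\<lambda>x. (4 + 2 * Q / m) * \<delta>\<^sup>2 + 2 / m * (?B x - ?T x))"
  proof (rule integral_I_mono[of _ _ "F \<union> G \<union> H"])
    fix x assume x: "x \<in> {-1<..<1} - (F \<union> G \<union> H)"
    then have x': "x \<in> {-1..1}" "x \<in> {-1<..<1} - F" by auto
    have e': "deriv e x = (deriv u x - deriv u\<^sub>I x) + deriv z x" using x G H by simp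
    have ex: "e x = (u x - u\<^sub>I x) + z x" by (simp add: e_def z_def)
    show "\<epsilon> * (deriv e x)\<^sup>2 + (e x)\<^sup>2 \<le> (4 + 2 * Q / m) * \<delta>\<^sup>2 + 2 / m * (?B x - ?T x)"
      unfolding e' ex Q_def m_def
      by (rule energy_density_estimate[OF \<epsilon> \<gamma> \<delta> coerc[OF x'(1)] a(2)[OF x'(1)] c(2)[OF x'(1)]
          abs_ge_zero A h[OF x'(2)] h'[OF x'(2)]])
  next
    show "pw_continuous (\<lambda>x. (4 + 2 * Q / m) * \<delta>\<^sup>2 + 2 / m * (?B x - ?T x))"
      by (intro pw_intros i iT)
  qed (use F G H in \<open>auto intro!: pw_intros i\<close>)
  also have "\<dots> = 2 * ((4 + 2 * Q / m) * \<delta>\<^sup>2) + 2 / m * (integral_I ?B - integral_I ?T)"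
  proof -
    have "pw_continuous (\<lambda>x. 2 / m * (?B x - ?T x))" by (intro pw_intros i iT)
    from integral_I_add[OF pw_continuous_const this, of "(4 + 2 * Q / m) * \<delta>\<^sup>2"]
    have "integral_I (\<lambda>x. (4 + 2 * Q / m) * \<delta>\<^sup>2 + 2 / m * (?B x - ?T x)) =
       2 * ((4 + 2 * Q / m) * \<delta>\<^sup>2) + 2 / m * integral_I (\<lambda>x. ?B x - ?T x)"
      by (simp only: integral_I_const set_integral_mult_right)
    moreover have "integral_I (\<lambda>x. ?B x - ?T x) = integral_I ?B - integral_I ?T"
      by (intro integral_I_diff pw_intros i iT)
    ultimately show ?thesis by simp
  qed
  also have "\<dots> = (8 + 4 * Q / m) * \<delta>\<^sup>2"
    unfolding B0 T0 by (simp add: algebra_simps)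
  finally have "sqrt ((energy_norm \<epsilon> e)\<^sup>2) \<le> sqrt ((8 + 4 * Q / m) * \<delta>\<^sup>2)"
    by (rule real_sqrt_le_mono)
  then show ?thesis
    using \<delta> by (simp add: real_sqrt_mult e_def Q_def m_def)
qed

section \<open>Polynomial approximation on one interval\<close>

lemma poly_antiderivative:
  fixes q :: "real poly"
  shows "\<exists>p. pderiv p = q \<and> poly p l = y \<and> degree p \<le> Suc (degree q)"
proof -
  define p0 where "p0 = (\<Sum>i\<le>degree q. monom (coeff q i / real (Suc i)) (Suc i))"
  have "pderiv p0 = (\<Sum>i\<le>degree q. monom (coeff q i) i)"
    unfolding p0_def
    by (simp add: higher_pderiv_sum[of 1, simplified] pderiv_monom del: of_nat_Suc)
  then have "pderiv p0 = q" by (simp add: poly_as_sum_of_monoms)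
  moreover have "degree p0 \<le> Suc (degree q)"
    unfolding p0_def by (intro degree_sum_le) (auto intro: order_trans[OF degree_monom_le])
  ultimately show ?thesis
    by (intro exI[of _ "p0 + [:y - poly p0 l:]"])
       (auto simp: pderiv_add pderiv_pCons intro!: degree_add_le)
qed

lemma has_real_derivative_poly_within:
  "(poly p has_real_derivative poly (pderiv p) x) (at x within S)"
  using poly_DERIV has_field_derivative_at_within by blast

lemma increment_le_derivative_bound:
  fixes g :: "real \<Rightarrow> real"
  assumes "\<And>x. x \<in> {l..r} \<Longrightarrow> (g has_real_derivative g' x) (at x within {l..r})"
    and "\<And>x. x \<in> {l..r} \<Longrightarrow> \<bar>g' x\<bar> \<le> B"
    and "x \<in> {l..r}"
  shows "\<bar>g x - g l\<bar> \<le> B * (r - l)"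
proof -
  have "\<bar>g x - g l\<bar> \<le> B * \<bar>x - l\<bar>"
    using field_differentiable_bound[of "{l..r}" g g' B x l] assms by auto
  also have "\<dots> \<le> B * (r - l)"
    using assms(2)[of l] assms(3) by (intro mult_left_mono) auto
  finally show ?thesis .
qed

text \<open>
  The polynomial is a Taylor polynomial, obtained by integrating the Taylor polynomial of the derivative
  instead of through Taylor's formula. In this way derivatives within the closed interval suffice, and
  the estimate for \<^term>\<open>D 1\<close> is part of the induction.
\<close>
lemma taylor_approximation:
  assumes "l \<le> r"
    and "\<And>i x. i \<le> k \<Longrightarrow> x \<in> {l..r} \<Longrightarrow> (D i has_real_derivative D (Suc i) x) (at x within {l..r})"
    and "\<And>x. x \<in> {l..r} \<Longrightarrow> \<bar>D (Suc k) x\<bar> \<le> M"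
  shows "\<exists>p. degree p \<le> k \<and> poly p l = D 0 l \<and>
    (\<forall>x\<in>{l..r}. \<bar>D 0 x - poly p x\<bar> \<le> M * (r - l) ^ Suc k \<and>
                \<bar>D 1 x - poly (pderiv p) x\<bar> \<le> M * (r - l) ^ k)"
  using assms(2,3)
proof (induction k arbitrary: D)
  case 0
  have "\<bar>D 0 x - D 0 l\<bar> \<le> M * (r - l)" if "x \<in> {l..r}" for x
    by (rule increment_le_derivative_bound[OF _ _ that]) (use 0 in auto)
  then show ?case
    using 0 by (intro exI[of _ "[:D 0 l:]"]) (auto simp: pderiv_pCons)
next
  case (Suc k)
  have "\<exists>q. degree q \<le> k \<and> poly q l = D (Suc 0) l \<and>
    (\<forall>x\<in>{l..r}. \<bar>D (Suc 0) x - poly q x\<bar> \<le> M * (r - l) ^ Suc k \<and>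
                \<bar>D (Suc 1) x - poly (pderiv q) x\<bar> \<le> M * (r - l) ^ k)"
    by (rule Suc.IH) (use Suc.prems in auto)
  then obtain q where q: "degree q \<le> k"
    "\<And>x. x \<in> {l..r} \<Longrightarrow> \<bar>D 1 x - poly q x\<bar> \<le> M * (r - l) ^ Suc k" by auto
  obtain p where p: "pderiv p = q" "poly p l = D 0 l" "degree p \<le> Suc (degree q)"
    using poly_antiderivative by blast
  have "\<bar>D 0 x - poly p x\<bar> \<le> M * (r - l) ^ Suc (Suc k)" if "x \<in> {l..r}" for x
  proof -
    have "\<bar>(D 0 x - poly p x) - (D 0 l - poly p l)\<bar> \<le> M * (r - l) ^ Suc k * (r - l)"
    proof (rule increment_le_derivative_bound[OF _ _ that])
      fix y assume y: "y \<in> {l..r}"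
      show "((\<lambda>x. D 0 x - poly p x) has_real_derivative (D 1 y - poly q y)) (at y within {l..r})"
        using Suc.prems(1)[of 0 y] y p(1) has_real_derivative_poly_within[of p y "{l..r}"]
        by (intro DERIV_diff) auto
    qed (rule q(2))
    then show ?thesis using p(2) by (simp add: algebra_simps)
  qed
  then show ?case using p q by (intro exI[of _ p]) auto
qed

text \<open>
  Adding to the Taylor polynomial the linear function that vanishes at \<open>l\<close> and removes the error at \<open>r\<close>
  costs only a factor of two. Matching the values at both end points makes the global
  approximant continuous.
\<close>
lemma endpoint_interpolation:
  assumes "l < r" and k: "1 \<le> k"
    and "\<And>i x. i \<le> k \<Longrightarrow> x \<in> {l..r} \<Longrightarrow> (D i has_real_derivative D (Suc i) x) (at x within {l..r})"
    and "\<And>x. x \<in> {l..r} \<Longrightarrow> \<bar>D (Suc k) x\<bar> \<le> M"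
  shows "\<exists>p. degree p \<le> k \<and> poly p l = D 0 l \<and> poly p r = D 0 r \<and>
    (\<forall>x\<in>{l..r}. \<bar>D 0 x - poly p x\<bar> \<le> 2 * M * (r - l) ^ Suc k \<and>
                \<bar>D 1 x - poly (pderiv p) x\<bar> \<le> 2 * M * (r - l) ^ k)"
proof -
  obtain q where q: "degree q \<le> k" "poly q l = D 0 l"
    "\<And>x. x \<in> {l..r} \<Longrightarrow> \<bar>D 0 x - poly q x\<bar> \<le> M * (r - l) ^ Suc k"
    "\<And>x. x \<in> {l..r} \<Longrightarrow> \<bar>D 1 x - poly (pderiv q) x\<bar> \<le> M * (r - l) ^ k"
    using taylor_approximation[of l r k D M] assms by auto
  define d where "d = (D 0 r - poly q r) / (r - l)"
  define p where "p = q + smult d [:- l, 1:]"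
  have px: "poly p x = poly q x + d * (x - l)" for x by (simp add: p_def algebra_simps)
  have p'x: "poly (pderiv p) x = poly (pderiv q) x + d" for x
    by (simp add: p_def pderiv_add pderiv_smult pderiv_pCons)
  have "\<bar>D 0 r - poly q r\<bar> \<le> M * (r - l) ^ Suc k" using q(3)[of r] assms(1) by auto
  then have d: "\<bar>d\<bar> \<le> M * (r - l) ^ k"
    using assms(1) by (simp add: d_def abs_divide divide_le_eq mult.assoc mult.commute[of "r - l"])
  have dx: "\<bar>d * (x - l)\<bar> \<le> M * (r - l) ^ Suc k" if "x \<in> {l..r}" for x
  proof -
    have "\<bar>d * (x - l)\<bar> \<le> M * (r - l) ^ k * (r - l)"
      unfolding abs_mult using d that by (intro mult_mono) auto
    then show ?thesis by (simp add: mult.assoc mult.commute[of "r - l"])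
  qed
  have "degree p \<le> k"
    unfolding p_def using q(1) k by (intro degree_add_le) (auto intro: order_trans[OF degree_smult_le])
  moreover have "poly p r = D 0 r" using assms(1) by (simp add: px d_def)
  moreover have "\<bar>D 0 x - poly p x\<bar> \<le> 2 * M * (r - l) ^ Suc k" if "x \<in> {l..r}" for x
    unfolding px using q(3)[OF that] dx[OF that] by linarith
  moreover have "\<bar>D 1 x - poly (pderiv p) x\<bar> \<le> 2 * M * (r - l) ^ k" if "x \<in> {l..r}" for x
    unfolding p'x using q(4)[OF that] d by linarith
  ultimately show ?thesis using q(2) by (intro exI[of _ p]) (auto simp: px)
qed

text \<open>
  The variant for an interval on which higher derivatives are too large to be of use: only the oscillation
  \<open>\<omega>\<close> enters.
\<close>
lemma linear_interpolation:
  fixes g :: "real \<Rightarrow> real"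
  assumes "l < r" and "\<And>x. x \<in> {l..r} \<Longrightarrow> \<bar>g x - g l\<bar> \<le> \<omega>"
  shows "\<exists>p. degree p \<le> 1 \<and> poly p l = g l \<and> poly p r = g r \<and>
    (\<forall>x\<in>{l..r}. \<bar>g x - poly p x\<bar> \<le> 2 * \<omega> \<and> \<bar>poly (pderiv p) x\<bar> \<le> \<omega> / (r - l))"
proof -
  define d where "d = (g r - g l) / (r - l)"
  define p where "p = [:g l - d * l, d:]"
  have px: "poly p x = g l + d * (x - l)" for x by (simp add: p_def algebra_simps)
  have p'x: "poly (pderiv p) x = d" for x by (simp add: p_def pderiv_pCons)
  have \<omega>: "\<bar>g r - g l\<bar> \<le> \<omega>" using assms by auto
  then have d: "\<bar>d\<bar> \<le> \<omega> / (r - l)"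
    using assms(1) by (simp add: d_def abs_divide divide_right_mono)
  have dx: "\<bar>d * (x - l)\<bar> \<le> \<omega>" if "x \<in> {l..r}" for x
  proof -
    have "\<bar>d * (x - l)\<bar> \<le> \<omega> / (r - l) * (r - l)"
      unfolding abs_mult using d that by (intro mult_mono) auto
    then show ?thesis using assms(1) by simp
  qed
  have "\<bar>g x - poly p x\<bar> \<le> 2 * \<omega>" if "x \<in> {l..r}" for x
    unfolding px using assms(2)[OF that] dx[OF that] by linarith
  then show ?thesis
    using d assms(1) by (intro exI[of _ p]) (auto simp: px p'x, auto simp: p_def d_def)
qed

lemma increment_le_majorant:
  fixes g G :: "real \<Rightarrow> real"
  assumes "l \<le> x"
    and "continuous_on {l..x} g" "continuous_on {l..x} G"
    and "\<And>y. l < y \<Longrightarrow> y < x \<Longrightarrow> (g has_real_derivative g' y) (at y)"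
    and "\<And>y. l < y \<Longrightarrow> y < x \<Longrightarrow> (G has_real_derivative G' y) (at y)"
    and "\<And>y. l < y \<Longrightarrow> y < x \<Longrightarrow> \<bar>g' y\<bar> \<le> G' y"
  shows "\<bar>g x - g l\<bar> \<le> G x - G l"
proof -
  have "G l - g l \<le> G x - g x"
  proof (rule DERIV_nonneg_imp_increasing_open[OF assms(1), of "\<lambda>y. G y - g y"])
    fix y assume y: "l < y" "y < x"
    show "\<exists>d. ((\<lambda>y. G y - g y) has_real_derivative d) (at y) \<and> 0 \<le> d"
      using assms(4-6)[OF y] by (intro exI[of _ "G' y - g' y"]) (auto intro: DERIV_diff)
  qed (intro continuous_on_diff assms)
  moreover have "G l + g l \<le> G x + g x"
  proof (rule DERIV_nonneg_imp_increasing_open[OF assms(1), of "\<lambda>y. G y + g y"])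
    fix y assume y: "l < y" "y < x"
    show "\<exists>d. ((\<lambda>y. G y + g y) has_real_derivative d) (at y) \<and> 0 \<le> d"
      using assms(4-6)[OF y] by (intro exI[of _ "G' y + g' y"]) (auto intro: DERIV_add)
  qed (intro continuous_on_add assms)
  ultimately show ?thesis by linarith
qed

text \<open>
  If \<open>lam < 1\<close>, the slope near the turning point may be as large as \<open>s powr (lam - 1)\<close>, so length times maximal
  slope is too crude. Integrating the bound on the slope gives \<open>T powr lam\<close> instead. The hypothesis that
  the interval does not contain the origin in its interior makes \<open>\<bar>y\<bar>\<close> differentiable there.
\<close>
lemma oscillation_bound:
  fixes g :: "real \<Rightarrow> real"
  assumes lam: "0 < lam" and s: "0 < s" and C: "0 \<le> C"
    and side: "0 \<le> l \<or> r \<le> 0" and x: "x \<in> {l..r}"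
    and T: "\<And>y. y \<in> {l..r} \<Longrightarrow> s + \<bar>y\<bar> \<le> T" and len: "r - l \<le> T"
    and g: "\<And>y. y \<in> {l..r} \<Longrightarrow> (g has_real_derivative g' y) (at y within {l..r})"
    and g': "\<And>y. y \<in> {l..r} \<Longrightarrow> \<bar>g' y\<bar> \<le> C * (1 + (s + \<bar>y\<bar>) powr (lam - 1))"
  shows "\<bar>g x - g l\<bar> \<le> C * (T + T powr lam / lam)"
proof -
  have cg: "continuous_on {l..x} g"
    using DERIV_continuous_on[OF g] x by (auto intro: continuous_on_subset)
  have Dg: "(g has_real_derivative g' y) (at y)" if "l < y" "y < x" for y
    using g[of y] that x at_within_Icc_at[of l y r] by auto
  have Tp: "(s + \<bar>y\<bar>) powr lam \<le> T powr lam" if "y \<in> {l..r}" for y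
    using T[OF that] s lam by (intro powr_mono2) auto
  show ?thesis
    using side
  proof
    assume l: "0 \<le> l"
    let ?G = "\<lambda>y. C * (y + (s + y) powr lam / lam)"
    have "\<bar>g x - g l\<bar> \<le> ?G x - ?G l"
    proof (rule increment_le_majorant[OF _ cg _ Dg])
      fix y assume y: "l < y" "y < x"
      show "(?G has_real_derivative C * (1 + (s + y) powr (lam - 1))) (at y)"
        using y l s lam by (auto intro!: derivative_eq_intros)
      show "\<bar>g' y\<bar> \<le> C * (1 + (s + y) powr (lam - 1))"
        using g'[of y] y l x by auto
    qed (use x l s lam in \<open>auto intro!: continuous_intros\<close>)
    also have "\<dots> = C * ((x - l) + ((s + x) powr lam - (s + l) powr lam) / lam)"
      by (simp add: algebra_simps diff_divide_distrib)
    also have "\<dots> \<le> C * (T + T powr lam / lam)"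
    proof (intro mult_left_mono add_mono divide_right_mono)
      have "(s + x) powr lam \<le> T powr lam" using Tp[OF x] x l by auto
      moreover have "0 \<le> (s + l) powr lam" by simp
      ultimately show "(s + x) powr lam - (s + l) powr lam \<le> T powr lam" by linarith
    qed (use x len C lam in auto)
    finally show ?thesis .
  next
    assume r: "r \<le> 0"
    let ?G = "\<lambda>y. C * (y - (s - y) powr lam / lam)"
    have "\<bar>g x - g l\<bar> \<le> ?G x - ?G l"
    proof (rule increment_le_majorant[OF _ cg _ Dg])
      fix y assume y: "l < y" "y < x"
      show "(?G has_real_derivative C * (1 + (s - y) powr (lam - 1))) (at y)"
        using y r x s lam by (auto intro!: derivative_eq_intros)
      show "\<bar>g' y\<bar> \<le> C * (1 + (s - y) powr (lam - 1))"
        using g'[of y] y r x by auto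
    qed (use x r s lam in \<open>auto intro!: continuous_intros\<close>)
    also have "\<dots> = C * ((x - l) + ((s - l) powr lam - (s - x) powr lam) / lam)"
      by (simp add: algebra_simps diff_divide_distrib)
    also have "\<dots> \<le> C * (T + T powr lam / lam)"
    proof (intro mult_left_mono add_mono divide_right_mono)
      have "(s - l) powr lam \<le> T powr lam" using Tp[of l] x r by auto
      moreover have "0 \<le> (s - x) powr lam" by simp
      ultimately show "(s - l) powr lam - (s - x) powr lam \<le> T powr lam" by linarith
    qed (use x len C lam in auto)
    finally show ?thesis .
  qed
qed

section \<open>Approximation on the graded mesh intervals\<close>

text \<open>
  The purpose of the grading. With \<open>t = s + \<bar>x\<bar>\<close> the mesh is equidistant, with step \<open>\<kappa> = O(1/N)\<close>, in the variable
  \<open>y = t powr (1/q)\<close>. On the step from \<open>B\<close> to \<open>B + \<kappa> \<le> 2 B\<close> all values of \<open>t\<close> are comparable with \<open>B powr q\<close> and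
  the length is of the order \<open>\<kappa> B powr (q - 1)\<close>. Hence weight times length to the power \<open>k\<close> times the bound on the
  derivative of order \<open>k + 1\<close> is of the order
  \<open>B powr q * (\<kappa> B powr (q - 1)) ^ k * B powr (q (lam - k - 1)) = \<kappa> ^ k * B powr (q lam - k)\<close>,
  where the last exponent is nonnegative.
\<close>
lemma graded_step_estimate:
  fixes q lam B \<kappa> :: real and k N :: nat
  assumes q: "1 \<le> q" and B: "0 < B" and \<kappa>: "0 < \<kappa>" "\<kappa> \<le> B" "B + \<kappa> \<le> 2" "\<kappa> \<le> 2 / real N"
    and N: "1 \<le> N" and lam: "real k \<le> q * lam" "lam < real (k + 1)"
  defines "\<tau> \<equiv> B powr q" and "T \<equiv> (B + \<kappa>) powr q" and "e \<equiv> lam - real (k + 1)"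
  shows "T * ((T - \<tau>) ^ k * (1 + \<tau> powr e)) \<le>
    2 powr q * (q * 2 powr q) ^ k * (1 + 2 powr (- q * e)) * 2 ^ k * 2 powr (q * lam - k)
      * real N powr (- real k)"
proof -
  have T: "T \<le> 2 powr q * B powr q"
  proof -
    have "T \<le> (2 * B) powr q" unfolding T_def using B \<kappa> q by (intro powr_mono2) auto
    then show ?thesis using B by (simp add: powr_mult)
  qed
  have \<tau>T: "0 \<le> T - \<tau>" unfolding T_def \<tau>_def using B \<kappa> q by (simp add: powr_mono2)
  have h: "T - \<tau> \<le> \<kappa> * (q * 2 powr q) * B powr (q - 1)"
  proof -
    have "\<exists>z>B. z < B + \<kappa> \<and> (B + \<kappa>) powr q - B powr q = (B + \<kappa> - B) * (q * z powr (q - 1))"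
      using B \<kappa> by (intro MVT2) (auto intro!: derivative_eq_intros)
    then obtain z where z: "B < z" "z < B + \<kappa>" "T - \<tau> = \<kappa> * (q * z powr (q - 1))"
      unfolding T_def \<tau>_def by auto
    have "z powr (q - 1) \<le> (2 * B) powr (q - 1)" using z B \<kappa> q by (intro powr_mono2) auto
    also have "\<dots> = 2 powr (q - 1) * B powr (q - 1)" using B by (simp add: powr_mult)
    also have "\<dots> \<le> 2 powr q * B powr (q - 1)" by (intro mult_right_mono powr_mono) auto
    finally have "\<kappa> * (q * z powr (q - 1)) \<le> \<kappa> * (q * (2 powr q * B powr (q - 1)))"
      using q \<kappa> by (intro mult_left_mono) auto
    then show ?thesis using z by (simp add: mult.assoc)
  qed
  have M: "1 + \<tau> powr e \<le> (1 + 2 powr (- q * e)) * B powr (q * e)"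
  proof -
    have "q * e \<le> 0" using q lam unfolding e_def by (simp add: mult_nonneg_nonpos)
    then have "2 powr (q * e) \<le> B powr (q * e)" using B \<kappa> by (intro powr_mono2') auto
    \<comment> \<open>As \<open>B \<le> 2\<close> and \<open>e < 0\<close>, the constant \<open>1\<close> is dominated by a multiple of \<open>\<tau> powr e\<close>.\<close>
    then have "2 powr (- q * e) * 2 powr (q * e) \<le> 2 powr (- q * e) * B powr (q * e)"
      by (intro mult_left_mono) auto
    then have "1 \<le> 2 powr (- q * e) * B powr (q * e)" by (simp flip: powr_add)
    moreover have "\<tau> powr e = B powr (q * e)" by (simp add: \<tau>_def powr_powr)
    ultimately show ?thesis by (simp add: algebra_simps)
  qed
  have B_le: "B powr q * ((B powr (q - 1)) ^ k * B powr (q * e)) \<le> 2 powr (q * lam - k)"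
  proof -
    have "(B powr (q - 1)) ^ k = B powr ((q - 1) * k)"
      using B by (simp add: powr_powr flip: powr_realpow)
    then have "B powr q * ((B powr (q - 1)) ^ k * B powr (q * e))
        = B powr (q + ((q - 1) * k + q * e))" by (simp add: powr_add)
    also have "q + ((q - 1) * k + q * e) = q * lam - k"
      by (simp add: e_def algebra_simps)
    also have "B powr (q * lam - k) \<le> 2 powr (q * lam - k)"
      using B \<kappa> lam by (intro powr_mono2) auto
    finally show ?thesis .
  qed
  have \<kappa>k: "\<kappa> ^ k \<le> 2 ^ k * real N powr (- real k)"
  proof -
    have "\<kappa> ^ k \<le> (2 / real N) ^ k" using \<kappa> by (intro power_mono) auto
    then show ?thesis using N by (simp add: power_divide powr_minus powr_realpow divide_inverse power_inverse)
  qed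
  have "T * ((T - \<tau>) ^ k * (1 + \<tau> powr e)) \<le> (2 powr q * B powr q) *
      ((\<kappa> * (q * 2 powr q) * B powr (q - 1)) ^ k * ((1 + 2 powr (- q * e)) * B powr (q * e)))"
    using T h M \<tau>T q \<kappa> by (intro mult_mono power_mono) (auto simp: add_nonneg_nonneg)
  also have "\<dots> = 2 powr q * (q * 2 powr q) ^ k * (1 + 2 powr (- q * e)) *
      (\<kappa> ^ k * (B powr q * ((B powr (q - 1)) ^ k * B powr (q * e))))"
    by (simp only: power_mult_distrib mult_ac)
  also have "\<dots> \<le> 2 powr q * (q * 2 powr q) ^ k * (1 + 2 powr (- q * e)) *
      ((2 ^ k * real N powr (- real k)) * 2 powr (q * lam - k))"
    using B_le \<kappa>k q \<kappa> by (intro mult_left_mono mult_mono) (auto simp: add_nonneg_nonneg)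
  finally show ?thesis by (simp only: mult_ac)
qed

text \<open>
  A mesh interval on one side of the origin, seen through \<open>t = s + \<bar>x\<bar>\<close>: \<open>t powr (1/q)\<close> runs through the step
  from \<open>B\<close> to \<open>B + \<kappa>\<close> of an equidistant mesh. Phrased in terms of \<open>\<bar>x\<bar>\<close>, it covers both halves of the mesh.
\<close>
definition graded_interval :: "real \<Rightarrow> real \<Rightarrow> real \<Rightarrow> real \<Rightarrow> real \<Rightarrow> real \<Rightarrow> bool" where
  "graded_interval q s B \<kappa> l r \<longleftrightarrow>
     0 < B \<and> 0 < \<kappa> \<and> B + \<kappa> \<le> 2 \<and> l < r \<and> r - l = (B + \<kappa>) powr q - B powr q \<and> (0 \<le> l \<or> r \<le> 0) \<and>
     (\<forall>x\<in>{l..r}. B powr q \<le> s + \<bar>x\<bar> \<and> s + \<bar>x\<bar> \<le> (B + \<kappa>) powr q)"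

text \<open>
  On each mesh interval one of two approximants works. If \<open>\<kappa> \<le> B\<close>, the values of \<open>t = s + \<bar>x\<bar>\<close> are comparable,
  and a polynomial of degree \<open>k\<close> does. Otherwise the whole interval lies in the region where \<open>t\<close> is at most
  \<open>(4/N) powr q\<close>; there \<open>t\<close> and \<open>t powr lam\<close> are already of the order \<open>N powr (- k)\<close>, and linear interpolation
  suffices because \<open>D 0\<close> hardly varies. The index \<open>i\<close> of \<open>D\<close> is the order of the derivative, and \<open>K\<close> depends
  on \<open>q\<close>, \<open>lam\<close> and \<open>k\<close> only.
\<close>
lemma local_approximation:
  fixes q lam :: real and k :: nat
  assumes k: "1 \<le> k" and lam: "0 < lam" "lam < real (k + 1)"
    and q: "real k \<le> q" "real k \<le> q * lam"
  shows "\<exists>K>0. \<forall>B \<kappa> s l r C (N::nat) D.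
     graded_interval q s B \<kappa> l r \<and> \<kappa> \<le> 2 / real N \<and> 1 \<le> N \<and> 0 < s \<and> 0 \<le> C \<and>
     (\<forall>i\<le>k. \<forall>x\<in>{l..r}. (D i has_real_derivative D (Suc i) x) (at x within {l..r})) \<and>
     (\<forall>i\<le>Suc k. \<forall>x\<in>{l..r}. \<bar>D i x\<bar> \<le> C * (1 + (s + \<bar>x\<bar>) powr (lam - real i))) \<longrightarrow>
     (\<exists>p. degree p \<le> k \<and> poly p l = D 0 l \<and> poly p r = D 0 r \<and>
       (\<forall>x\<in>{l..r}. \<bar>D 0 x - poly p x\<bar> \<le> K * C * real N powr (- real k) \<and>
          (s + \<bar>x\<bar>) * \<bar>D 1 x - poly (pderiv p) x\<bar> \<le> K * C * real N powr (- real k)))"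
proof -
  define e where "e = lam - real (k + 1)"
  define K1 where "K1 = 2 powr q * (q * 2 powr q) ^ k * (1 + 2 powr (- q * e)) * 2 ^ k
    * 2 powr (q * lam - k)"
  define K2 where "K2 = 3 * 4 powr q + (1 + 2 / lam) * 4 powr (q * lam)"
  have q1: "1 \<le> q" using k q by simp
  have K1: "0 \<le> K1" unfolding K1_def using q1 by (intro mult_nonneg_nonneg) (auto simp: add_nonneg_nonneg)
  have K2: "0 < K2" unfolding K2_def using lam by (intro add_pos_pos mult_pos_pos) auto
  show ?thesis
  proof (intro exI[of _ "2 * K1 + K2"] conjI allI impI; (elim conjE)?)
    show "0 < 2 * K1 + K2" using K1 K2 by simp
    fix B \<kappa> s l r C :: real and N :: nat and D :: "nat \<Rightarrow> real \<Rightarrow> real"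
    assume gi: "graded_interval q s B \<kappa> l r" and "\<kappa> \<le> 2 / real N" and N: "1 \<le> N"
      and s: "0 < s" and C: "0 \<le> C"
      and D: "\<forall>i\<le>k. \<forall>x\<in>{l..r}. (D i has_real_derivative D (Suc i) x) (at x within {l..r})"
      and bd: "\<forall>i\<le>Suc k. \<forall>x\<in>{l..r}. \<bar>D i x\<bar> \<le> C * (1 + (s + \<bar>x\<bar>) powr (lam - real i))"
    have B: "0 < B" and \<kappa>: "0 < \<kappa>" "B + \<kappa> \<le> 2" "\<kappa> \<le> 2 / real N"
      and lr: "l < r" "r - l = (B + \<kappa>) powr q - B powr q" and side: "0 \<le> l \<or> r \<le> 0"
      and t: "\<forall>x\<in>{l..r}. B powr q \<le> s + \<bar>x\<bar> \<and> s + \<bar>x\<bar> \<le> (B + \<kappa>) powr q"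
      using gi \<open>\<kappa> \<le> 2 / real N\<close> unfolding graded_interval_def by auto
    define \<tau> where "\<tau> = B powr q"
    define T where "T = (B + \<kappa>) powr q"
    define P where "P = real N powr (- real k)"
    have P: "0 < P" using N by (simp add: P_def)
    have \<tau>: "0 < \<tau>" "0 < T" using B \<kappa> by (auto simp: \<tau>_def T_def)
    have h: "r - l = T - \<tau>" "r - l \<le> T" using lr \<tau> by (auto simp: \<tau>_def T_def)
    have tx: "\<tau> \<le> s + \<bar>x\<bar>" "s + \<bar>x\<bar> \<le> T" "0 \<le> s + \<bar>x\<bar>" if "x \<in> {l..r}" for x
      using t that s by (auto simp: \<tau>_def T_def)
    have "\<exists>p \<delta>. degree p \<le> k \<and> poly p l = D 0 l \<and> poly p r = D 0 r \<and> \<delta> \<le> (2 * K1 + K2) * C * P \<and>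
       (\<forall>x\<in>{l..r}. \<bar>D 0 x - poly p x\<bar> \<le> \<delta> \<and> (s + \<bar>x\<bar>) * \<bar>D 1 x - poly (pderiv p) x\<bar> \<le> \<delta>)"
    proof (cases "\<kappa> \<le> B")
      case True
      define M where "M = C * (1 + \<tau> powr e)"
      have M0: "0 \<le> M" using C by (simp add: M_def)
      have M: "\<bar>D (Suc k) x\<bar> \<le> M" if "x \<in> {l..r}" for x
      proof -
        have "(s + \<bar>x\<bar>) powr e \<le> \<tau> powr e"
          using tx[OF that] \<tau> lam by (intro powr_mono2') (auto simp: e_def)
        then have "C * (1 + (s + \<bar>x\<bar>) powr e) \<le> M"
          unfolding M_def using C by (intro mult_left_mono) auto
        moreover have "\<bar>D (Suc k) x\<bar> \<le> C * (1 + (s + \<bar>x\<bar>) powr e)"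
          using bd that unfolding e_def by (simp del: of_nat_Suc)
        ultimately show ?thesis by linarith
      qed
      obtain p where p: "degree p \<le> k" "poly p l = D 0 l" "poly p r = D 0 r"
        "\<And>x. x \<in> {l..r} \<Longrightarrow> \<bar>D 0 x - poly p x\<bar> \<le> 2 * M * (r - l) ^ Suc k"
        "\<And>x. x \<in> {l..r} \<Longrightarrow> \<bar>D 1 x - poly (pderiv p) x\<bar> \<le> 2 * M * (r - l) ^ k"
        using endpoint_interpolation[OF lr(1) k, of D M] D M by auto
      define \<delta> where "\<delta> = T * (2 * M * (r - l) ^ k)"
      have a: "0 \<le> 2 * M * (r - l) ^ k" using M0 lr by simp
      have "T * ((T - \<tau>) ^ k * (1 + \<tau> powr e)) \<le> K1 * P"
        unfolding T_def \<tau>_def e_def K1_def P_def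
        by (rule graded_step_estimate) (use q1 B \<kappa> N q lam True in auto)
      then have "2 * C * (T * ((T - \<tau>) ^ k * (1 + \<tau> powr e))) \<le> 2 * C * (K1 * P)"
        using C by (intro mult_left_mono) auto
      then have "\<delta> \<le> 2 * C * (K1 * P)"
        unfolding \<delta>_def M_def h(1) by (simp only: mult_ac)
      also have "\<dots> \<le> 2 * C * (K1 * P) + K2 * C * P" using K2 C P by simp
      also have "\<dots> = (2 * K1 + K2) * C * P" by (simp add: algebra_simps)
      finally have "\<delta> \<le> (2 * K1 + K2) * C * P" .
      moreover have "\<bar>D 0 x - poly p x\<bar> \<le> \<delta>" if "x \<in> {l..r}" for x
      proof -
        have "2 * M * (r - l) ^ Suc k = (r - l) * (2 * M * (r - l) ^ k)" by simp
        also have "\<dots> \<le> \<delta>" unfolding \<delta>_def using a h by (intro mult_right_mono) auto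
        finally show ?thesis using p(4)[OF that] by linarith
      qed
      moreover have "(s + \<bar>x\<bar>) * \<bar>D 1 x - poly (pderiv p) x\<bar> \<le> \<delta>" if "x \<in> {l..r}" for x
        unfolding \<delta>_def using tx[OF that] p(5)[OF that] \<tau> by (intro mult_mono) auto
      ultimately show ?thesis using p by blast
    next
      case False
      define \<omega> where "\<omega> = C * (T + T powr lam / lam)"
      have osc: "\<bar>D 0 x - D 0 l\<bar> \<le> \<omega>" if "x \<in> {l..r}" for x
        unfolding \<omega>_def
      proof (rule oscillation_bound[OF lam(1) s C side that tx(2) h(2), where g' = "D 1"])
        show "(D 0 has_real_derivative D 1 y) (at y within {l..r})" if "y \<in> {l..r}" for y
          using D that by force
        show "\<bar>D 1 y\<bar> \<le> C * (1 + (s + \<bar>y\<bar>) powr (lam - 1))" if "y \<in> {l..r}" for y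
          using bd[rule_format, of 1 y] that by simp
      qed
      obtain p where p: "degree p \<le> 1" "poly p l = D 0 l" "poly p r = D 0 r"
        "\<And>x. x \<in> {l..r} \<Longrightarrow> \<bar>D 0 x - poly p x\<bar> \<le> 2 * \<omega>"
        "\<And>x. x \<in> {l..r} \<Longrightarrow> \<bar>poly (pderiv p) x\<bar> \<le> \<omega> / (r - l)"
        using linear_interpolation[OF lr(1), of "D 0" \<omega>] osc by auto
      have \<omega>0: "0 \<le> \<omega>" using osc[of l] lr(1) by auto
      \<comment> \<open>Here \<open>B < \<kappa>\<close>, so the length \<open>T - \<tau>\<close> of the interval is at least \<open>T/2\<close>; this bounds the weighted slope of the interpolant.\<close>
      have "2 * \<tau> \<le> T"
      proof -
        have "2 powr 1 \<le> (2::real) powr q" using q1 by (intro powr_mono) auto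
        then have "2 * \<tau> \<le> 2 powr q * B powr q" unfolding \<tau>_def by (intro mult_right_mono) auto
        also have "\<dots> = (2 * B) powr q" using B by (simp add: powr_mult)
        also have "\<dots> \<le> T" unfolding T_def using False B q1 by (intro powr_mono2) auto
        finally show ?thesis .
      qed
      moreover have "0 < T - \<tau>" using lr(1) h(1) by simp
      ultimately have Th: "T / (r - l) \<le> 2" by (simp add: h(1) pos_divide_le_eq)
      have T4: "T \<le> 4 powr q * real N powr (- q)"
      proof -
        have "B + \<kappa> \<le> 4 / real N" using False \<kappa> by simp
        then have "T \<le> (4 / real N) powr q"
          unfolding T_def using B \<kappa> q1 by (intro powr_mono2) auto
        then show ?thesis by (simp add: powr_divide powr_minus_divide)
      qed
      have T1: "T \<le> 4 powr q * P"
      proof -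
        have "real N powr (- q) \<le> P" unfolding P_def using N q by (intro powr_mono) auto
        then have "4 powr q * real N powr (- q) \<le> 4 powr q * P" by (intro mult_left_mono) auto
        then show ?thesis using T4 by linarith
      qed
      have T2: "T powr lam \<le> 4 powr (q * lam) * P"
      proof -
        have "T powr lam \<le> (4 powr q * real N powr (- q)) powr lam"
          using T4 \<tau> lam by (intro powr_mono2) auto
        also have "\<dots> = 4 powr (q * lam) * real N powr (- (q * lam))"
          by (simp add: powr_mult powr_powr)
        also have "\<dots> \<le> 4 powr (q * lam) * P"
          unfolding P_def using N q by (intro mult_left_mono powr_mono) auto
        finally show ?thesis .
      qed
      define \<delta> where "\<delta> = C * (T + T powr lam) + 2 * \<omega>"
      have "\<delta> = C * (3 * T + (1 + 2 / lam) * T powr lam)"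
        by (simp add: \<delta>_def \<omega>_def algebra_simps)
      also have "\<dots> \<le> C * (3 * (4 powr q * P) + (1 + 2 / lam) * (4 powr (q * lam) * P))"
        using T1 T2 C lam by (intro mult_left_mono add_mono) auto
      also have "\<dots> = K2 * C * P" by (simp add: K2_def algebra_simps)
      also have "\<dots> \<le> 2 * K1 * C * P + K2 * C * P" using K1 C P by simp
      also have "\<dots> = (2 * K1 + K2) * C * P" by (simp add: algebra_simps)
      finally have "\<delta> \<le> (2 * K1 + K2) * C * P" .
      moreover have "\<bar>D 0 x - poly p x\<bar> \<le> \<delta>" if "x \<in> {l..r}" for x
      proof -
        have "0 \<le> C * (T + T powr lam)" using C \<tau> by simp
        then show ?thesis using p(4)[OF that] by (simp add: \<delta>_def)
      qed
      moreover have "(s + \<bar>x\<bar>) * \<bar>D 1 x - poly (pderiv p) x\<bar> \<le> \<delta>" if "x \<in> {l..r}" for x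
      proof -
        let ?t = "s + \<bar>x\<bar>"
        have tp: "0 < ?t" using s by simp
        have "?t * \<bar>D 1 x\<bar> \<le> ?t * (C * (1 + ?t powr (lam - 1)))"
          using bd[rule_format, of 1 x] that tp by (intro mult_left_mono) auto
        also have "\<dots> = C * (?t + ?t powr lam)"
          using powr_add[of ?t 1 "lam - 1"] tp by (simp add: algebra_simps)
        also have "\<dots> \<le> C * (T + T powr lam)"
          using C tx[OF that] tp lam by (intro mult_left_mono add_mono powr_mono2) auto
        finally have 1: "?t * \<bar>D 1 x\<bar> \<le> C * (T + T powr lam)" .
        have "?t * \<bar>poly (pderiv p) x\<bar> \<le> T * (\<omega> / (r - l))"
          using tx[OF that] p(5)[OF that] \<tau> by (intro mult_mono) auto
        also have "\<dots> = (T / (r - l)) * \<omega>" by simp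
        also have "\<dots> \<le> 2 * \<omega>" using Th \<omega>0 by (intro mult_right_mono) auto
        finally have 2: "?t * \<bar>poly (pderiv p) x\<bar> \<le> 2 * \<omega>" .
        have "?t * \<bar>D 1 x - poly (pderiv p) x\<bar> \<le> ?t * (\<bar>D 1 x\<bar> + \<bar>poly (pderiv p) x\<bar>)"
          using tp by (intro mult_left_mono) auto
        then show ?thesis using 1 2 by (simp add: \<delta>_def distrib_left)
      qed
      moreover have "degree p \<le> k" using p(1) k by simp
      ultimately show ?thesis using p by blast
    qed
    then show "\<exists>p. degree p \<le> k \<and> poly p l = D 0 l \<and> poly p r = D 0 r \<and>
       (\<forall>x\<in>{l..r}. \<bar>D 0 x - poly p x\<bar> \<le> (2 * K1 + K2) * C * real N powr (- real k) \<and>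
          (s + \<bar>x\<bar>) * \<bar>D 1 x - poly (pderiv p) x\<bar> \<le> (2 * K1 + K2) * C * real N powr (- real k))"
      unfolding P_def by (meson order_trans)
  qed
qed

section \<open>Geometry of the mesh\<close>

lemma mesh_point_pos:
  assumes "0 < \<alpha>"
  shows "mesh_point \<alpha> \<epsilon> N (int j) =
    (\<epsilon> powr (\<alpha>/2) + real j * (((1 + \<epsilon> powr (1/2)) powr \<alpha> - \<epsilon> powr (\<alpha>/2)) / real N)) powr (1/\<alpha>)
      - \<epsilon> powr (1/2)"
  by (simp add: mesh_point_def mesh_fun_def)

text \<open>
  The mesh generating function has separate branches for the two halves; they agree up to sign at
  \<open>\<xi> = 0\<close> because both vanish there.
\<close>
lemma mesh_point_neg:
  assumes "0 < \<alpha>" "0 < \<epsilon>" "1 \<le> N"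
  shows "mesh_point \<alpha> \<epsilon> N (- int j) = - mesh_point \<alpha> \<epsilon> N (int j)"
proof (cases "j = 0")
  case True
  have "(\<epsilon> powr (\<alpha>/2)) powr (1/\<alpha>) = \<epsilon> powr (1/2)" using assms by (simp add: powr_powr)
  then show ?thesis using True by (simp add: mesh_point_def mesh_fun_def)
next
  case False
  then have "\<not> 0 \<le> - real j / real N" using assms by (simp add: field_simps)
  then show ?thesis by (simp add: mesh_point_def mesh_fun_def)
qed

text \<open>
  The choice \<open>q = 1/\<alpha>\<close> inverts the mesh generating function: with \<open>A = \<epsilon> powr (\<alpha>/2) = s powr \<alpha>\<close> the mesh
  points are \<open>\<plusminus>((A + j \<kappa>) powr (1/\<alpha>) - s)\<close>, so \<open>B = A + j \<kappa>\<close> for the interval between the points of index \<open>j\<close>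
  and \<open>j + 1\<close>, and for its mirror image.
\<close>
lemma mesh_interval:
  assumes \<alpha>: "0 < \<alpha>" "\<alpha> \<le> 1" and \<epsilon>: "0 < \<epsilon>" "\<epsilon> \<le> 1" and N: "1 \<le> N"
    and i: "i \<in> {- int N + 1..int N}"
  defines "s \<equiv> \<epsilon> powr (1/2)"
    and "l \<equiv> mesh_point \<alpha> \<epsilon> N (i - 1)" and "r \<equiv> mesh_point \<alpha> \<epsilon> N i"
    and "\<kappa> \<equiv> ((1 + \<epsilon> powr (1/2)) powr \<alpha> - \<epsilon> powr (\<alpha>/2)) / real N"
  shows "\<exists>B. graded_interval (1/\<alpha>) s B \<kappa> l r" and "\<kappa> \<le> 2 / real N"
proof -
  define A where "A = \<epsilon> powr (\<alpha>/2)"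
  define t where "t = (\<lambda>j::nat. (A + real j * \<kappa>) powr (1/\<alpha>))"
  have s: "0 < s" "s \<le> 1" using \<epsilon> powr_mono2[of "1/2" \<epsilon> 1] by (auto simp: s_def)
  have As: "A = s powr \<alpha>" by (simp add: A_def s_def powr_powr)
  have A: "0 < A" using \<epsilon> by (simp add: A_def)
  have \<kappa>N: "real N * \<kappa> = (1 + s) powr \<alpha> - A" using N by (simp add: \<kappa>_def s_def A_def)
  \<comment> \<open>The last mesh point corresponds to \<open>A + N \<kappa> = (1 + s) powr \<alpha>\<close>, which bounds all \<open>B + \<kappa>\<close>.\<close>
  have two: "(1 + s) powr \<alpha> \<le> 2"
  proof -
    have "(1 + s) powr \<alpha> \<le> 2 powr \<alpha>" using s \<alpha> by (intro powr_mono2) auto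
    also have "\<dots> \<le> 2 powr 1" using \<alpha> by (intro powr_mono) auto
    finally show ?thesis by simp
  qed
  have "s powr \<alpha> < (1 + s) powr \<alpha>" using s \<alpha> by (intro powr_less_mono2) auto
  then have "0 < real N * \<kappa>" using \<kappa>N As by simp
  then have \<kappa>: "0 < \<kappa>" using N by (simp add: zero_less_mult_iff)
  have \<kappa>2: "\<kappa> \<le> 2 / real N" using \<kappa>N two A N by (simp add: field_simps)
  have ts: "s \<le> t j" for j
  proof -
    have "s = A powr (1/\<alpha>)" using As \<alpha> s by (simp add: powr_powr)
    also have "\<dots> \<le> t j" unfolding t_def using A \<kappa> \<alpha> by (intro powr_mono2) auto
    finally show ?thesis .
  qed
  have pos: "mesh_point \<alpha> \<epsilon> N (int j) = t j - s" for j
    using mesh_point_pos[OF \<alpha>(1)] by (simp add: t_def A_def \<kappa>_def s_def)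
  have neg: "mesh_point \<alpha> \<epsilon> N (- int j) = s - t j" for j
    using mesh_point_neg[OF \<alpha>(1) \<epsilon>(1) N] pos by simp
  have main: "\<exists>B. graded_interval (1/\<alpha>) s B \<kappa> l r" if j: "j < N" and lr: "(l = t j - s \<and> r = t (Suc j) - s) \<or> (l = s - t (Suc j) \<and> r = s - t j)" for j
  proof -
    define B where "B = A + real j * \<kappa>"
    have B: "0 < B" unfolding B_def using A \<kappa> by (intro add_pos_nonneg) auto
    have "(real j + 1) * \<kappa> \<le> real N * \<kappa>" using j \<kappa> by (intro mult_right_mono) auto
    then have B2: "B + \<kappa> \<le> 2" using \<kappa>N two by (simp add: B_def algebra_simps)
    have tj: "t j = B powr (1/\<alpha>)" "t (Suc j) = (B + \<kappa>) powr (1/\<alpha>)"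
      by (auto simp: t_def B_def algebra_simps)
    have tl: "t j < t (Suc j)"
      unfolding tj using B \<kappa> \<alpha> by (intro powr_less_mono2) auto
    show ?thesis
      unfolding graded_interval_def
      using lr ts[of j] tl by (intro exI[of _ B] conjI B \<kappa> B2) (auto simp flip: tj)
  qed
  show "\<kappa> \<le> 2 / real N" by (rule \<kappa>2)
  show "\<exists>B. graded_interval (1/\<alpha>) s B \<kappa> l r"
  proof (cases "1 \<le> i")
    case True
    define j where "j = nat (i - 1)"
    have "i - 1 = int j" "i = int (Suc j)" "j < N" using True i by (auto simp: j_def)
    then show ?thesis using pos[of j] pos[of "Suc j"] by (intro main[of j]) (auto simp: l_def r_def)
  next
    case False
    define j where "j = nat (- i)"
    have ij: "i - 1 = - int (Suc j)" "i = - int j" and "j < N" using False i by (auto simp: j_def)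
    have "l = s - t (Suc j)" "r = s - t j" by (simp_all only: l_def r_def ij(1) neg) (simp only: ij(2) neg)
    then show ?thesis using \<open>j < N\<close> by (intro main[of j]) auto
  qed
qed

lemma mesh_ends:
  assumes "0 < \<alpha>" "0 < \<epsilon>" "1 \<le> N"
  shows "mesh_point \<alpha> \<epsilon> N (int N) = 1" "mesh_point \<alpha> \<epsilon> N (- int N) = -1"
proof -
  show "mesh_point \<alpha> \<epsilon> N (int N) = 1"
    using assms by (simp add: mesh_point_pos powr_powr)
  then show "mesh_point \<alpha> \<epsilon> N (- int N) = -1"
    using mesh_point_neg[OF assms, of N] by simp
qed

section \<open>Piecewise polynomials\<close>

lemma nodes_mono:
  fixes X :: "int \<Rightarrow> real"
  assumes mono: "\<And>i. i \<in> {m + 1..n} \<Longrightarrow> X (i - 1) < X i"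
    and "m \<le> i" "i \<le> j" "j \<le> n"
  shows "X i \<le> X j"
  using assms(3,4)
proof (induction j rule: int_ge_induct)
  case (step j)
  then show ?case using mono[of "j + 1"] assms(2) by auto
qed simp

lemma nodes_cover:
  fixes X :: "int \<Rightarrow> real"
  assumes "m < n" "X m \<le> x" "x \<le> X n"
  shows "\<exists>i\<in>{m + 1..n}. X (i - 1) \<le> x \<and> x \<le> X i"
proof -
  have "x \<le> X n \<longrightarrow> (\<exists>i\<in>{m + 1..n}. X (i - 1) \<le> x \<and> x \<le> X i)"
    using assms(1)
  proof (induction n rule: int_gr_induct)
    case base
    then show ?case using assms(2) by auto
  next
    case (step n)
    show ?case
    proof (cases "x \<le> X n")
      case True
      then obtain i where "i \<in> {m + 1..n}" "X (i - 1) \<le> x" "x \<le> X i" using step by blast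
      then show ?thesis by (intro impI bexI[of _ i]) auto
    next
      case False
      then show ?thesis using step(1) by (intro impI bexI[of _ "n + 1"]) auto
    qed
  qed
  then show ?thesis using assms by blast
qed

text \<open>
  Two pieces can only meet in a common node, where both agree with \<open>u\<close>.
\<close>
lemma piecewise_polynomial_exists:
  fixes X :: "int \<Rightarrow> real" and p :: "int \<Rightarrow> real poly" and u :: "real \<Rightarrow> real"
  assumes mono: "\<And>i. i \<in> {m + 1..n} \<Longrightarrow> X (i - 1) < X i"
    and ends: "m < n" "X m = -1" "X n = 1"
    and interp: "\<And>i. i \<in> {m + 1..n} \<Longrightarrow> poly (p i) (X (i - 1)) = u (X (i - 1)) \<and> poly (p i) (X i) = u (X i)"
  shows "\<exists>v. continuous_on {-1..1} v \<and> (\<forall>i\<in>{m + 1..n}. \<forall>y\<in>{X (i - 1)..X i}. v y = poly (p i) y)"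
proof -
  let ?J = "{m + 1..n}"
  have agree: "poly (p i) y = poly (p j) y"
    if "i \<in> ?J" "j \<in> ?J" "i < j" "y \<in> {X (i - 1)..X i}" "y \<in> {X (j - 1)..X j}" for i j y
  proof -
    have "X i \<le> X (j - 1)" using that by (intro nodes_mono[of m n X] mono) auto
    then have "y = X i" "y = X (j - 1)" using that by auto
    then show ?thesis using interp that by metis
  qed
  define v where "v = (\<lambda>y. poly (p (SOME i. i \<in> ?J \<and> y \<in> {X (i - 1)..X i})) y)"
  have v: "v y = poly (p i) y" if "i \<in> ?J" "y \<in> {X (i - 1)..X i}" for i y
  proof -
    define j where "j = (SOME i. i \<in> ?J \<and> y \<in> {X (i - 1)..X i})"
    have j: "j \<in> ?J \<and> y \<in> {X (j - 1)..X j}"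
      unfolding j_def by (rule someI[of _ i]) (use that in blast)
    have "poly (p j) y = poly (p i) y"
    proof (cases i j rule: linorder_cases)
      case less
      then show ?thesis using agree[of i j y] j that by simp
    next
      case greater
      then show ?thesis using agree[of j i y] j that by simp
    qed simp
    then show ?thesis by (simp only: v_def j_def)
  qed
  have "continuous_on (\<Union>i\<in>?J. {X (i - 1)..X i}) v"
  proof (rule continuous_on_closed_Union)
    fix i assume "i \<in> ?J"
    then show "continuous_on {X (i - 1)..X i} v"
      using v by (intro continuous_on_eq[of _ "poly (p i)" v]) (auto intro!: continuous_intros)
  qed auto
  moreover have "{-1..1} \<subseteq> (\<Union>i\<in>?J. {X (i - 1)..X i})"
    using nodes_cover[of m n X] ends by fastforce
  ultimately show ?thesis using v continuous_on_subset by blast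
qed

lemma piecewise_polynomial_deriv:
  fixes v :: "real \<Rightarrow> real"
  assumes "\<And>y. y \<in> {l<..<r} \<Longrightarrow> v y = poly p y" "y \<in> {l<..<r}"
  shows "(v has_real_derivative poly (pderiv p) y) (at y)"
  by (rule has_field_derivative_transform_within_open[OF poly_DERIV, where S = "{l<..<r}"])
     (use assms in auto)

text \<open>
  The derivative is bounded because there are finitely many pieces.
\<close>
lemma piecewise_polynomial_pw_C1:
  fixes X :: "int \<Rightarrow> real"
  assumes ends: "m < n" "X m = -1" "X n = 1"
    and v: "continuous_on {-1..1} v"
    and p: "\<And>i. i \<in> {m + 1..n} \<Longrightarrow> \<exists>p. \<forall>y\<in>{X (i - 1)<..<X i}. v y = poly p y"
  shows "pw_C1 v"
proof -
  let ?J = "{m + 1..n}"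
  obtain q where q: "\<And>i y. i \<in> ?J \<Longrightarrow> y \<in> {X (i - 1)<..<X i} \<Longrightarrow> v y = poly (q i) y"
    using p by metis
  let ?F = "X ` {m..n}"
  have loc: "\<exists>i\<in>?J. y \<in> {X (i - 1)<..<X i}" if "y \<in> {-1<..<1} - ?F" for y
  proof -
    have "\<exists>i\<in>?J. X (i - 1) \<le> y \<and> y \<le> X i"
      by (rule nodes_cover) (use ends that in auto)
    then obtain i where i: "i \<in> ?J" "X (i - 1) \<le> y" "y \<le> X i" by blast
    have "i \<in> {m..n}" "i - 1 \<in> {m..n}" using i by auto
    then have "y \<noteq> X (i - 1)" "y \<noteq> X i" using that by blast+
    then show ?thesis using i by (intro bexI[of _ i]) auto
  qed
  have D: "(v has_real_derivative poly (pderiv (q i)) y) (at y)"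
    if "i \<in> ?J" "y \<in> {X (i - 1)<..<X i}" for i y
    by (rule piecewise_polynomial_deriv[OF q that(2)]) (use that in auto)
  have d: "deriv v y = poly (pderiv (q i)) y" if "i \<in> ?J" "y \<in> {X (i - 1)<..<X i}" for i y
    using D[OF that] by (rule DERIV_imp_deriv)
  have "\<exists>B. \<forall>y\<in>{-1..1}. \<bar>poly (pderiv (q i)) y\<bar> \<le> B" for i
  proof -
    have "bounded (poly (pderiv (q i)) ` {-1..1})"
      by (intro compact_imp_bounded compact_continuous_image continuous_intros) auto
    then show ?thesis by (auto simp: bounded_iff)
  qed
  then obtain b where b: "\<And>i y. y \<in> {-1..1} \<Longrightarrow> \<bar>poly (pderiv (q i)) y\<bar> \<le> b i" by metis
  have "pw_continuous (deriv v)"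
  proof (rule pw_continuousI[of ?F _ "\<Sum>i\<in>?J. \<bar>b i\<bar>"])
    show "continuous_on ({-1<..<1} - ?F) (deriv v)"
    proof (rule continuous_at_imp_continuous_on, rule ballI)
      fix y assume "y \<in> {-1<..<1} - ?F"
      then obtain i where i: "i \<in> ?J" "y \<in> {X (i - 1)<..<X i}" using loc by blast
      have "(deriv v has_real_derivative poly (pderiv (pderiv (q i))) y) (at y)"
        by (rule piecewise_polynomial_deriv[OF d i(2)]) (use i in auto)
      then show "isCont (deriv v) y" by (rule DERIV_isCont)
    qed
    fix y assume y: "y \<in> {-1<..<1} - ?F"
    then obtain i where i: "i \<in> ?J" "y \<in> {X (i - 1)<..<X i}" using loc by blast
    have "\<bar>deriv v y\<bar> \<le> b i" using d[OF i] b[of y i] y by auto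
    also have "\<dots> \<le> \<bar>b i\<bar>" by simp
    also have "\<dots> \<le> (\<Sum>i\<in>?J. \<bar>b i\<bar>)" using i(1) by (intro member_le_sum) auto
    finally show "\<bar>deriv v y\<bar> \<le> (\<Sum>i\<in>?J. \<bar>b i\<bar>)" .
  qed simp
  moreover have "(v has_real_derivative deriv v y) (at y)" if "y \<in> {-1<..<1} - ?F" for y
    using loc[OF that] D d by metis
  ultimately show ?thesis by (intro pw_C1I[OF v, of ?F "deriv v"]) auto
qed

lemma fe_space_piece:
  assumes "v \<in> fe_space k \<alpha> \<epsilon> N" "i \<in> {- int N + 1..int N}"
  obtains p where "degree p \<le> k"
    "\<And>x. x \<in> {mesh_point \<alpha> \<epsilon> N (i - 1)<..<mesh_point \<alpha> \<epsilon> N i} \<Longrightarrow> v x = poly p x"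
  using assms unfolding fe_space_def by blast

lemma fe_space_pw_C1:
  assumes "v \<in> fe_space k \<alpha> \<epsilon> N" "0 < \<alpha>" "0 < \<epsilon>" "1 \<le> N"
  shows "pw_C1 v" "v (-1) = 0" "v 1 = 0"
proof -
  have v: "continuous_on {-1..1} v" "v (-1) = 0" "v 1 = 0"
    using assms(1) by (simp_all add: fe_space_def)
  have pieces: "\<exists>p. \<forall>y\<in>{mesh_point \<alpha> \<epsilon> N (i - 1)<..<mesh_point \<alpha> \<epsilon> N i}. v y = poly p y"
      if "i \<in> {- int N + 1..int N}" for i
    using fe_space_piece[OF assms(1) that] by metis
  have "- int N < int N" using assms(4) by simp
  then show "pw_C1 v"
    by (rule piecewise_polynomial_pw_C1[OF _ mesh_ends(2,1)[OF assms(2-4)] v(1) pieces])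
  show "v (-1) = 0" "v 1 = 0" by (rule v)+
qed

lemma fe_space_diff:
  assumes "v \<in> fe_space k \<alpha> \<epsilon> N" "w \<in> fe_space k \<alpha> \<epsilon> N"
  shows "(\<lambda>x. v x - w x) \<in> fe_space k \<alpha> \<epsilon> N"
proof -
  have pieces: "\<exists>p. degree p \<le> k \<and>
      (\<forall>x\<in>{mesh_point \<alpha> \<epsilon> N (i - 1)<..<mesh_point \<alpha> \<epsilon> N i}. v x - w x = poly p x)"
    if i: "i \<in> {- int N + 1..int N}" for i
  proof -
    obtain p where "degree p \<le> k"
      "\<And>x. x \<in> {mesh_point \<alpha> \<epsilon> N (i - 1)<..<mesh_point \<alpha> \<epsilon> N i} \<Longrightarrow> v x = poly p x"
      using fe_space_piece[OF assms(1) i] by metis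
    moreover obtain q where "degree q \<le> k"
      "\<And>x. x \<in> {mesh_point \<alpha> \<epsilon> N (i - 1)<..<mesh_point \<alpha> \<epsilon> N i} \<Longrightarrow> w x = poly q x"
      using fe_space_piece[OF assms(2) i] by metis
    ultimately show ?thesis by (intro exI[of _ "p - q"]) (auto intro: degree_diff_le)
  qed
  have "continuous_on {-1..1} (\<lambda>x. v x - w x)" "v (-1) - w (-1) = 0" "v 1 - w 1 = 0"
    using assms by (simp_all add: fe_space_def continuous_on_diff)
  with pieces show ?thesis
    unfolding fe_space_def by blast
qed

section \<open>The global approximant and the error bound\<close>

text \<open>
  Gluing the local approximants. The exceptional set \<open>F\<close> consists of the mesh points, where the
  approximant has no derivative in general.
\<close>
lemma global_approximation:
  assumes k: "1 \<le> k" and lam: "0 < lam" "lam < real (k + 1)"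
    and \<alpha>: "0 < \<alpha>" "real k * \<alpha> \<le> 1" "real k * \<alpha> \<le> lam"
  shows "\<exists>K>0. \<forall>\<epsilon> N C u. 0 < \<epsilon> \<and> \<epsilon> \<le> 1 \<and> 1 \<le> N \<and> 0 \<le> C \<and> Cn (k + 1) u \<and> u (-1) = 0 \<and> u 1 = 0 \<and>
      (\<forall>i\<le>k + 1. \<forall>x\<in>{-1..1}. \<bar>iter_deriv i u x\<bar> \<le> C * (1 + (\<epsilon> powr (1/2) + \<bar>x\<bar>) powr (lam - real i))) \<longrightarrow>
      (\<exists>v\<in>fe_space k \<alpha> \<epsilon> N. \<exists>F. finite F \<and> (\<forall>x\<in>{-1<..<1} - F.
         \<bar>u x - v x\<bar> \<le> K * C * real N powr (- real k) \<and>
         (sqrt \<epsilon> + \<bar>x\<bar>) * \<bar>deriv u x - deriv v x\<bar> \<le> K * C * real N powr (- real k)))"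
proof -
  have \<alpha>1: "\<alpha> \<le> 1"
  proof -
    have "1 * \<alpha> \<le> real k * \<alpha>" using k \<alpha> by (intro mult_right_mono) auto
    then show ?thesis using \<alpha> by linarith
  qed
  have q: "real k \<le> 1/\<alpha>" "real k \<le> 1/\<alpha> * lam" using \<alpha> by (auto simp: field_simps)
  obtain K where K: "0 < K" and loc: "\<And>B \<kappa> s l r C (N::nat) D.
     graded_interval (1/\<alpha>) s B \<kappa> l r \<and> \<kappa> \<le> 2 / real N \<and> 1 \<le> N \<and> 0 < s \<and> 0 \<le> C \<and>
     (\<forall>i\<le>k. \<forall>x\<in>{l..r}. (D i has_real_derivative D (Suc i) x) (at x within {l..r})) \<and>
     (\<forall>i\<le>Suc k. \<forall>x\<in>{l..r}. \<bar>D i x\<bar> \<le> C * (1 + (s + \<bar>x\<bar>) powr (lam - real i))) \<Longrightarrow>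
     (\<exists>p. degree p \<le> k \<and> poly p l = D 0 l \<and> poly p r = D 0 r \<and>
       (\<forall>x\<in>{l..r}. \<bar>D 0 x - poly p x\<bar> \<le> K * C * real N powr (- real k) \<and>
          (s + \<bar>x\<bar>) * \<bar>D 1 x - poly (pderiv p) x\<bar> \<le> K * C * real N powr (- real k)))"
    using local_approximation[OF k lam q] by blast
  show ?thesis
  proof (intro exI[of _ K] conjI K allI impI; elim conjE)
    fix \<epsilon> C :: real and N :: nat and u
    assume \<epsilon>: "0 < \<epsilon>" "\<epsilon> \<le> 1" and N: "1 \<le> N" and C: "0 \<le> C" and u: "Cn (k + 1) u"
      and bc: "u (-1) = 0" "u 1 = 0"
      and bd: "\<forall>i\<le>k + 1. \<forall>x\<in>{-1..1}.
        \<bar>iter_deriv i u x\<bar> \<le> C * (1 + (\<epsilon> powr (1/2) + \<bar>x\<bar>) powr (lam - real i))"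
    define X where "X = mesh_point \<alpha> \<epsilon> N"
    define \<delta> where "\<delta> = K * C * real N powr (- real k)"
    let ?J = "{- int N + 1..int N}"
    let ?s = "\<epsilon> powr (1/2)"
    have ends: "- int N < int N" "X (- int N) = -1" "X (int N) = 1"
      using N mesh_ends[OF \<alpha>(1) \<epsilon>(1) N] by (auto simp: X_def)
    have mono: "X (i - 1) < X i" if "i \<in> ?J" for i
      using mesh_interval(1)[OF \<alpha>(1) \<alpha>1 \<epsilon> N that] by (auto simp: X_def graded_interval_def)
    have range: "-1 \<le> X (i - 1)" "X i \<le> 1" if "i \<in> ?J" for i
    proof -
      have "X (- int N) \<le> X (i - 1)" "X i \<le> X (int N)"
        using that by (auto intro!: nodes_mono[of "- int N" "int N" X] mono)
      then show "-1 \<le> X (i - 1)" "X i \<le> 1" using ends by auto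
    qed
    have "\<exists>p. degree p \<le> k \<and> poly p (X (i - 1)) = u (X (i - 1)) \<and> poly p (X i) = u (X i) \<and>
       (\<forall>x\<in>{X (i - 1)..X i}. \<bar>u x - poly p x\<bar> \<le> \<delta> \<and>
          (?s + \<bar>x\<bar>) * \<bar>iter_deriv 1 u x - poly (pderiv p) x\<bar> \<le> \<delta>)" if i: "i \<in> ?J" for i
    proof -
      let ?\<kappa> = "((1 + \<epsilon> powr (1/2)) powr \<alpha> - \<epsilon> powr (\<alpha>/2)) / real N"
      obtain B where B: "graded_interval (1/\<alpha>) ?s B ?\<kappa> (X (i - 1)) (X i)"
        using mesh_interval(1)[OF \<alpha>(1) \<alpha>1 \<epsilon> N i] by (auto simp: X_def)
      have "?\<kappa> \<le> 2 / real N" by (rule mesh_interval(2)[OF \<alpha>(1) \<alpha>1 \<epsilon> N i])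
      moreover have sub: "{X (i - 1)..X i} \<subseteq> {-1..1}" using range[OF i] by auto
      moreover have "(iter_deriv j u has_real_derivative iter_deriv (Suc j) u x) (at x within {X (i - 1)..X i})"
        if "j \<le> k" "x \<in> {X (i - 1)..X i}" for j x
        using Cn_has_derivative[OF u, of j x] that sub by (intro DERIV_subset[OF _ sub]) auto
      ultimately show ?thesis
        using loc[of ?s B ?\<kappa> "X (i - 1)" "X i" N C "\<lambda>i. iter_deriv i u"] B N \<epsilon> C bd
        unfolding \<delta>_def by (auto simp: subset_iff simp del: iter_deriv.simps(2) One_nat_def)
    qed
    then obtain p where p: "\<And>i. i \<in> ?J \<Longrightarrow> degree (p i) \<le> k"
      "\<And>i. i \<in> ?J \<Longrightarrow> poly (p i) (X (i - 1)) = u (X (i - 1)) \<and> poly (p i) (X i) = u (X i)"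
      "\<And>i x. i \<in> ?J \<Longrightarrow> x \<in> {X (i - 1)..X i} \<Longrightarrow> \<bar>u x - poly (p i) x\<bar> \<le> \<delta>"
      "\<And>i x. i \<in> ?J \<Longrightarrow> x \<in> {X (i - 1)..X i} \<Longrightarrow>
          (?s + \<bar>x\<bar>) * \<bar>iter_deriv 1 u x - poly (pderiv (p i)) x\<bar> \<le> \<delta>" by metis
    obtain v where v: "continuous_on {-1..1} v"
      "\<And>i y. i \<in> ?J \<Longrightarrow> y \<in> {X (i - 1)..X i} \<Longrightarrow> v y = poly (p i) y"
      using piecewise_polynomial_exists[OF mono ends p(2)] by blast
    have J: "int N \<in> ?J" "- int N + 1 \<in> ?J" using N by auto
    have "v 1 = 0" using v(2)[OF J(1), of 1] p(2)[OF J(1)] ends bc mono[OF J(1)] by auto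
    moreover have "v (-1) = 0" using v(2)[OF J(2), of "-1"] p(2)[OF J(2)] ends bc mono[OF J(2)] by auto
    moreover have "\<exists>p. degree p \<le> k \<and> (\<forall>x\<in>{X (i - 1)<..<X i}. v x = poly p x)"
      if "i \<in> ?J" for i
      using p(1) v(2) that by (intro exI[of _ "p i"]) auto
    ultimately have fe: "v \<in> fe_space k \<alpha> \<epsilon> N"
      using v(1) unfolding fe_space_def X_def by blast
    have est: "\<bar>u x - v x\<bar> \<le> \<delta> \<and> (sqrt \<epsilon> + \<bar>x\<bar>) * \<bar>deriv u x - deriv v x\<bar> \<le> \<delta>"
      if x: "x \<in> {-1<..<1} - X ` {- int N..int N}" for x
    proof -
      have "\<exists>i\<in>?J. X (i - 1) \<le> x \<and> x \<le> X i"
        by (rule nodes_cover) (use ends x in auto)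
      then obtain i where i: "i \<in> ?J" "X (i - 1) \<le> x" "x \<le> X i" by blast
      have "i \<in> {- int N..int N}" "i - 1 \<in> {- int N..int N}" using i by auto
      then have "x \<noteq> X (i - 1)" "x \<noteq> X i" using x by blast+
      then have xi: "x \<in> {X (i - 1)<..<X i}" "x \<in> {X (i - 1)..X i}" using i by auto
      have "(u has_real_derivative iter_deriv 1 u x) (at x)"
        using Cn_has_derivative[OF u, of 0 x] x by (auto dest: has_derivative_interior)
      then have "deriv u x = iter_deriv 1 u x" by (rule DERIV_imp_deriv)
      moreover have "(v has_real_derivative poly (pderiv (p i)) x) (at x)"
        by (rule piecewise_polynomial_deriv[OF v(2)[OF i(1)] xi(1)]) auto
      then have "deriv v x = poly (pderiv (p i)) x" by (rule DERIV_imp_deriv)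
      moreover have "v x = poly (p i) x" by (rule v(2)[OF i(1) xi(2)])
      moreover have "sqrt \<epsilon> = ?s" using \<epsilon> by (simp add: powr_half_sqrt)
      ultimately show ?thesis using p(3,4)[OF i(1) xi(2)] by simp
    qed
    show "\<exists>v\<in>fe_space k \<alpha> \<epsilon> N. \<exists>F. finite F \<and> (\<forall>x\<in>{-1<..<1} - F.
         \<bar>u x - v x\<bar> \<le> K * C * real N powr (- real k) \<and>
         (sqrt \<epsilon> + \<bar>x\<bar>) * \<bar>deriv u x - deriv v x\<bar> \<le> K * C * real N powr (- real k))"
      using fe est unfolding \<delta>_def[symmetric]
      by (intro bexI[of _ v] exI[of _ "X ` {- int N..int N}"]) auto
  qed
qed

theorem theorem3p5:
  fixes a b c f :: "real \<Rightarrow> real"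
    and k :: nat
    and \<gamma> \<epsilon>\<^sub>0 lam lam_bar \<alpha> :: real
  assumes k: "1 \<le> k"
    and smooth: "Cn k a" "Cn k c" "Cn k f"
    and b_cont: "continuous_on {-1..1} b"
    and b_pos: "\<forall>x\<in>{-1..1}. 0 < b x"
    and a_eq: "\<forall>x\<in>{-1..1}. a x = - x * b x"
    and c_nonneg: "\<forall>x\<in>{-1..1}. 0 \<le> c x"
    and c_pos: "0 < c 0"
    and gamma_pos: "0 < \<gamma>"
    and coercive: "\<forall>x\<in>{-1..1}. \<gamma> \<le> c x - 1/2 * iter_deriv 1 a x"
    and eps0: "0 < \<epsilon>\<^sub>0" "\<epsilon>\<^sub>0 \<le> 1"
    and lam_bar: "lam_bar = c 0 / \<bar>iter_deriv 1 a 0\<bar>"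
    and lam: "0 < lam" "lam < lam_bar \<or> (lam = lam_bar \<and> lam_bar \<notin> \<int>)"
    and lam_k: "lam < real (k + 1)"
    and known_bound: "derivative_bounds a c f \<epsilon>\<^sub>0 lam (k + 1)"
    and alpha: "0 < \<alpha>" "\<alpha> \<le> min (lam / real (k + 1)) (1 / (2 * real (k + 1)))"
  shows "\<exists>C>0. \<forall>\<epsilon> N u u\<^sub>N.
           0 < \<epsilon> \<and> \<epsilon> \<le> \<epsilon>\<^sub>0 \<and> 1 \<le> N \<and>
           bvp_solution a c f \<epsilon> u \<and> fe_solution a c f k \<alpha> \<epsilon> N u\<^sub>N \<longrightarrow>
           energy_norm \<epsilon> (\<lambda>x. u x - u\<^sub>N x) \<le> C * real N powr (- real k)"
proof -
  \<comment> \<open>The grading exponent enters only through \<open>q = 1/\<alpha>\<close>: these say \<open>k \<le> q\<close> and \<open>k \<le> q lam\<close>.\<close>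
  have \<alpha>k: "real k * \<alpha> \<le> 1" "real k * \<alpha> \<le> lam"
  proof -
    have "\<alpha> * real (k + 1) \<le> lam" "\<alpha> * (2 * real (k + 1)) \<le> 1"
      using alpha(2) by (auto simp: le_divide_eq)
    moreover have "0 \<le> \<alpha> * real k" using alpha(1) by simp
    ultimately show "real k * \<alpha> \<le> 1" "real k * \<alpha> \<le> lam" using alpha(1) by (auto simp: algebra_simps)
  qed
  have cont: "continuous_on {-1..1} a" "continuous_on {-1..1} c" "continuous_on {-1..1} f"
    using smooth[THEN Cn_continuous, of 0] by simp_all
  have bounded_cont: "\<exists>B. \<forall>x\<in>{-1..1}. \<bar>g x\<bar> \<le> B" if "continuous_on {-1..1} g" for g :: "real \<Rightarrow> real"
  proof -
    have "bounded (g ` {-1..1})"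
      using that by (intro compact_imp_bounded compact_continuous_image) auto
    then show ?thesis by (auto simp: bounded_iff)
  qed
  obtain A1 where A1: "\<forall>x\<in>{-1..1}. \<bar>b x\<bar> \<le> A1" using bounded_cont[OF b_cont] by blast
  obtain A2 where A2: "\<forall>x\<in>{-1..1}. \<bar>c x\<bar> \<le> A2" using bounded_cont[OF cont(2)] by blast
  define A where "A = \<bar>A1\<bar> + \<bar>A2\<bar>"
  have A: "0 \<le> A" by (simp add: A_def)
  have bA: "\<bar>b x\<bar> \<le> A" and cA: "\<bar>c x\<bar> \<le> A" if "x \<in> {-1..1}" for x
    using bspec[OF A1 that] bspec[OF A2 that] by (auto simp: A_def)
  have aA: "\<bar>a x\<bar> \<le> A * \<bar>x\<bar>" if "x \<in> {-1..1}" for x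
    using a_eq that mult_right_mono[OF bA[OF that] abs_ge_zero[of x]] by (simp add: abs_mult mult.commute)
  have Cn1: "Cn 1 a"
    unfolding Cn_def using k Cn_continuous[OF smooth(1), of 1] smooth(1)
    by (auto simp: Cn_def simp del: iter_deriv.simps(2))
  obtain C0 where C0: "\<And>\<epsilon> u. 0 < \<epsilon> \<Longrightarrow> \<epsilon> \<le> \<epsilon>\<^sub>0 \<Longrightarrow> bvp_solution a c f \<epsilon> u \<Longrightarrow> Cn (k + 1) u \<and>
        (\<forall>i\<le>k + 1. \<forall>x\<in>{-1..1}.
           \<bar>iter_deriv i u x\<bar> \<le> C0 * (1 + (\<epsilon> powr (1/2) + \<bar>x\<bar>) powr (lam - real i)))"
    using known_bound unfolding derivative_bounds_def by blast
  obtain K where K: "0 < K" and approx: "\<And>\<epsilon> N C u. 0 < \<epsilon> \<and> \<epsilon> \<le> 1 \<and> 1 \<le> N \<and> 0 \<le> C \<and> Cn (k + 1) u \<and>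
      u (-1) = 0 \<and> u 1 = 0 \<and>
      (\<forall>i\<le>k + 1. \<forall>x\<in>{-1..1}. \<bar>iter_deriv i u x\<bar> \<le> C * (1 + (\<epsilon> powr (1/2) + \<bar>x\<bar>) powr (lam - real i))) \<Longrightarrow>
      (\<exists>v\<in>fe_space k \<alpha> \<epsilon> N. \<exists>F. finite F \<and> (\<forall>x\<in>{-1<..<1} - F.
         \<bar>u x - v x\<bar> \<le> K * C * real N powr (- real k) \<and>
         (sqrt \<epsilon> + \<bar>x\<bar>) * \<bar>deriv u x - deriv v x\<bar> \<le> K * C * real N powr (- real k)))"
    using global_approximation[OF k lam(1) lam_k alpha(1) \<alpha>k] by blast
  define S where "S = sqrt (8 + 4 * (1/2 + 2 * A\<^sup>2 / \<gamma>) / min (1/2) (\<gamma>/2))"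
  have S: "0 \<le> S" unfolding S_def using gamma_pos by simp
  show ?thesis
  \<comment> \<open>The summand \<open>1\<close> keeps the constant positive when \<open>C0 = 0\<close>; the absolute value covers a negative \<open>C0\<close>.\<close>
  proof (intro exI[of _ "S * (K * \<bar>C0\<bar>) + 1"] conjI allI impI; (elim conjE)?)
    show "0 < S * (K * \<bar>C0\<bar>) + 1" using S K by (simp add: add_nonneg_pos)
    fix \<epsilon> N u u\<^sub>N
    assume \<epsilon>: "0 < \<epsilon>" "\<epsilon> \<le> \<epsilon>\<^sub>0" and N: "(1::nat) \<le> N" and u: "bvp_solution a c f \<epsilon> u"
      and uN: "fe_solution a c f k \<alpha> \<epsilon> N u\<^sub>N"
    define \<delta> where "\<delta> = K * \<bar>C0\<bar> * real N powr (- real k)"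
    have \<delta>: "0 \<le> \<delta>" using K by (simp add: \<delta>_def)
    have Cu: "Cn (k + 1) u" using C0[OF \<epsilon> u] by blast
    have bd: "\<bar>iter_deriv i u x\<bar> \<le> \<bar>C0\<bar> * (1 + (\<epsilon> powr (1/2) + \<bar>x\<bar>) powr (lam - real i))"
      if "i \<le> k + 1" "x \<in> {-1..1}" for i x
    proof -
      have "\<bar>iter_deriv i u x\<bar> \<le> C0 * (1 + (\<epsilon> powr (1/2) + \<bar>x\<bar>) powr (lam - real i))"
        using C0[OF \<epsilon> u] that by blast
      also have "\<dots> \<le> \<bar>C0\<bar> * (1 + (\<epsilon> powr (1/2) + \<bar>x\<bar>) powr (lam - real i))"
        by (intro mult_right_mono) (auto simp: add_nonneg_nonneg)
      finally show ?thesis .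
    qed
    have bc: "u (-1) = 0" "u 1 = 0" using u by (auto simp: bvp_solution_def)
    have "\<epsilon> \<le> 1" using \<epsilon> eps0 by simp
    then have "\<exists>v\<in>fe_space k \<alpha> \<epsilon> N. \<exists>F. finite F \<and> (\<forall>x\<in>{-1<..<1} - F.
         \<bar>u x - v x\<bar> \<le> \<delta> \<and> (sqrt \<epsilon> + \<bar>x\<bar>) * \<bar>deriv u x - deriv v x\<bar> \<le> \<delta>)"
      unfolding \<delta>_def by (intro approx conjI allI impI ballI \<epsilon>(1) N Cu bc bd abs_ge_zero)
    then obtain v F where v: "v \<in> fe_space k \<alpha> \<epsilon> N" and F: "finite F"
      and est: "\<And>x. x \<in> {-1<..<1} - F \<Longrightarrow> \<bar>u x - v x\<bar> \<le> \<delta>"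
        "\<And>x. x \<in> {-1<..<1} - F \<Longrightarrow> (sqrt \<epsilon> + \<bar>x\<bar>) * \<bar>deriv u x - deriv v x\<bar> \<le> \<delta>"
      by blast
    have uNfe: "u\<^sub>N \<in> fe_space k \<alpha> \<epsilon> N" using uN by (simp add: fe_solution_def)
    note vfe = fe_space_pw_C1[OF v alpha(1) \<epsilon>(1) N]
    note uNfe' = fe_space_pw_C1[OF uNfe alpha(1) \<epsilon>(1) N]
    define z where "z = (\<lambda>x. v x - u\<^sub>N x)"
    have z: "z \<in> fe_space k \<alpha> \<epsilon> N" unfolding z_def by (rule fe_space_diff[OF v uNfe])
    have "Cn 2 u"
      unfolding Cn_def using Cn_continuous[OF Cu, of 2] k Cu
      by (auto simp: Cn_def simp del: iter_deriv.simps(2))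
    note weak = weak_formulation[OF u this cont fe_space_pw_C1[OF z alpha(1) \<epsilon>(1) N]]
    have orth: "bilinear a c \<epsilon> u (\<lambda>x. v x - u\<^sub>N x) = bilinear a c \<epsilon> u\<^sub>N (\<lambda>x. v x - u\<^sub>N x)"
      using weak(2) uN z unfolding fe_solution_def z_def[symmetric] by metis
    have coerc: "\<gamma> \<le> c x - iter_deriv 1 a x / 2" if "x \<in> {-1..1}" for x
      using coercive that by simp
    have "energy_norm \<epsilon> (\<lambda>x. u x - u\<^sub>N x) \<le> S * \<delta>"
      unfolding S_def
      by (rule galerkin_error_bound[OF \<epsilon>(1) gamma_pos \<delta> A Cn1 aA cont(2) cA coerc weak(1)
            uNfe'(1) vfe(1) uNfe'(2,3) vfe(2,3) orth F est])
    also have "\<dots> \<le> (S * (K * \<bar>C0\<bar>) + 1) * real N powr (- real k)"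
      by (simp add: \<delta>_def algebra_simps)
    finally show "energy_norm \<epsilon> (\<lambda>x. u x - u\<^sub>N x) \<le> (S * (K * \<bar>C0\<bar>) + 1) * real N powr (- real k)" .
  qed
qed

end
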